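(* Let $N,n\in\mathbb N$ with $2\le n\le N$ and let $Z=(z_{j,r})\in\{0,1\}^{N\times n}$. Put $\widetilde z_r=\frac1N\sum_{j=1}^N z_{j,r}$, $y_{u,v,r}=z_{u,r}-z_{v,r}$, $$\beta=\frac1n\sum_{r=1}^n\widetilde z_r^{\,2},\qquad \vartheta=\frac{1}{N(N-1)\sqrt{n(n-1)}}\Big(\sum_{(r,s)\in[n]^2_{\neq}}\Big(\sum_{(u,v)\in[N]^2_{\neq}}|y_{u,v,r}\,y_{u,v,s}|\Big)^2\Big)^{1/2},$$ and $f_n(x_1,x_2)=\sum_{k=2}^n(k-1)x_1^{n-k}x_2^{k-2}$. Let $\zeta(k)=(k!)^{1/k}$ for $k\in\mathbb N$ and $\zeta(0)=0$. For $(u,v)\in[N]^2_{\neq}$ and $\ell\in[n]$ let $\eta_{u,v,\ell}=\sum_{j\in[N]\setminus\{u,v\}}z_{j,\ell}$ and $\widetilde\kappa_{u,v,\ell}=\dfrac{(\zeta(\eta_{u,v,\ell}))^2}{((N-2)!)^{2/(N-2)}}$, and set $$\widetilde\kappa=\begin{cases}\dfrac{1}{n-2}\displaystyle\max_{(u,v)\in[N]^2_{\neq},\,(r,s)\in[n]^2_{\neq}}\ \sum_{\ell\in[n]\setminus\{r,s\}}\widetilde\kappa_{u,v,\ell},& n\ge3,\\[2mm] 1,& n=2.\end{cases}$$ Then $$\Big|\frac{(N-n)!}{N!}\operatorname{Per}(Z)-\prod_{r=1}^n\widetilde z_r\Big|\le\frac{\vartheta}{2N}\,f_n\big(\sqr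t\beta,\sqrt{\widetilde\kappa}\big).$$
   Context: $[m]=\{1,\dots,m\}$. $[N]^n_{\neq}$ denotes the set of injective maps $j:[n]\to[N]$, written as tuples $(j_1,\dots,j_n)$; $[N]^2_{\neq}=\{(u,v)\in[N]^2:u\ne v\}$. $\operatorname{Per}(Z)=\sum_{j\in[N]^n_{\neq}}\prod_{r=1}^n z_{j_r,r}$. Convention $0^0=1$. *)

theory Defs
  imports "HOL-Analysis.Analysis"
begin

text \<open>
  An \<open>N \<times> n\<close> matrix with entries in \<open>{0, 1}\<close> is a function \<open>z :: nat \<Rightarrow> nat \<Rightarrow> nat\<close>, where \<open>z j r\<close>
  is the entry in row \<open>j\<close> and column \<open>r\<close>; only indices \<open>j \<in> {1..N}\<close>, \<open>r \<in> {1..n}\<close> matter.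
  The entries are naturals so that the column counts \<open>eta\<close> below are naturals, as the argument of
  \<open>zeta\<close> has to be.
\<close>

definition inj_tuples :: "nat \<Rightarrow> nat \<Rightarrow> (nat \<Rightarrow> nat) set" where
  "inj_tuples N n = {j \<in> {1..n} \<rightarrow>\<^sub>E {1..N}. inj_on j {1..n}}"

definition distinct_pairs :: "nat \<Rightarrow> (nat \<times> nat) set" where
  "distinct_pairs m = {(u, v). u \<in> {1..m} \<and> v \<in> {1..m} \<and> u \<noteq> v}"

definition Per :: "nat \<Rightarrow> nat \<Rightarrow> (nat \<Rightarrow> nat \<Rightarrow> nat) \<Rightarrow> nat" where
  "Per N n z = (\<Sum>j\<in>inj_tuples N n. \<Prod>r=1..n. z (j r) r)"

definition col_mean :: "nat \<Rightarrow> (nat \<Rightarrow> nat \<Rightarrow> nat) \<Rightarrow> nat \<Rightarrow> real" where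
  "col_mean N z r = (1 / real N) * (\<Sum>j=1..N. real (z j r))"

definition row_diff :: "(nat \<Rightarrow> nat \<Rightarrow> nat) \<Rightarrow> nat \<Rightarrow> nat \<Rightarrow> nat \<Rightarrow> real" where
  "row_diff z u v r = real (z u r) - real (z v r)"

definition beta :: "nat \<Rightarrow> nat \<Rightarrow> (nat \<Rightarrow> nat \<Rightarrow> nat) \<Rightarrow> real" where
  "beta N n z = (1 / real n) * (\<Sum>r=1..n. (col_mean N z r)\<^sup>2)"

definition vartheta :: "nat \<Rightarrow> nat \<Rightarrow> (nat \<Rightarrow> nat \<Rightarrow> nat) \<Rightarrow> real" where
  "vartheta N n z =
     1 / (real N * (real N - 1) * sqrt (real n * (real n - 1))) *
     sqrt (\<Sum>(r, s)\<in>distinct_pairs n.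
             (\<Sum>(u, v)\<in>distinct_pairs N. \<bar>row_diff z u v r * row_diff z u v s\<bar>)\<^sup>2)"

definition f_poly :: "nat \<Rightarrow> real \<Rightarrow> real \<Rightarrow> real" where
  "f_poly n x1 x2 = (\<Sum>k=2..n. (real k - 1) * x1 ^ (n - k) * x2 ^ (k - 2))"

definition zeta :: "nat \<Rightarrow> real" where
  "zeta k = (if k = 0 then 0 else fact k powr (1 / real k))"

definition eta :: "nat \<Rightarrow> (nat \<Rightarrow> nat \<Rightarrow> nat) \<Rightarrow> nat \<Rightarrow> nat \<Rightarrow> nat \<Rightarrow> nat" where
  "eta N z u v l = (\<Sum>j\<in>{1..N} - {u, v}. z j l)"

text \<open>
  The exponent \<open>2 / (N - 2)\<close> is meaningful only for \<open>N \<ge> 3\<close>; \<open>kappa\<close> uses \<open>kappa_entry\<close> only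
  for \<open>n \<ge> 3\<close>, where \<open>N \<ge> n\<close> guarantees this.
\<close>

definition kappa_entry :: "nat \<Rightarrow> (nat \<Rightarrow> nat \<Rightarrow> nat) \<Rightarrow> nat \<Rightarrow> nat \<Rightarrow> nat \<Rightarrow> real" where
  "kappa_entry N z u v l =
     (zeta (eta N z u v l))\<^sup>2 / fact (N - 2) powr (2 / (real N - 2))"

definition kappa :: "nat \<Rightarrow> nat \<Rightarrow> (nat \<Rightarrow> nat \<Rightarrow> nat) \<Rightarrow> real" where
  "kappa N n z =
     (if n \<ge> 3 then
        1 / (real n - 2) *
        Max ((\<lambda>((u, v), (r, s)). \<Sum>l\<in>{1..n} - {r, s}. kappa_entry N z u v l) `
               (distinct_pairs N \<times> distinct_pairs n))
      else 1)"

end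

theory Submission
  imports Defs
begin

text \<open>
  For a random injection \<open>J\<close> let \<open>p A\<close> be the mean of \<open>\<Prod>t\<in>A. z (J t) t\<close>, so that \<open>p {1..n}\<close> is the normalized
  permanent, and let \<open>m r\<close> be the mean of column \<open>r\<close>. Sampling without replacement differs from independent sampling only through collisions,
  which gives \<open>p (insert r A) - m r * p A\<close> as \<open>- 1 / (2 N)\<close> times a sum over \<open>s \<in> A\<close> of averages, over pairs of rows
  \<open>u \<noteq> v\<close>, of \<open>y u v r * y u v s\<close> times the normalized permanent for the columns \<open>A - {s}\<close> and the rows other than
  \<open>u\<close> and \<open>v\<close>. The averages of \<open>p A * (\<Prod>l\<notin>A. m l)\<close> over all \<open>A\<close> with \<open>k\<close> elements interpolate between the
  product of the means and \<open>p {1..n}\<close>; consecutive ones differ by an average of such covariance terms.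
  In it the smaller permanents are bounded by the Bregman-Minc inequality, the Cauchy-Schwarz inequality separates
  the row differences, the means \<open>m\<close> and the Bregman-Minc factors, and Maclaurin's inequality bounds
  the elementary symmetric means that remain by powers of \<open>\<beta>\<close> and \<open>\<kappa>\<close>.
\<close>

section \<open>Permanents as averages over injections\<close>

text \<open>Arbitrary row and column sets replace the intervals of \<open>inj_tuples\<close>,
  because expansions delete rows and columns. Extensionality makes an injection determined by its
  values on \<open>A\<close>.\<close>

definition injs :: "'a set \<Rightarrow> 'b set \<Rightarrow> ('a \<Rightarrow> 'b) set" where
  "injs A B = {f \<in> A \<rightarrow>\<^sub>E B. inj_on f A}"

definition per_on :: "('b \<Rightarrow> 'a \<Rightarrow> real) \<Rightarrow> 'a set \<Rightarrow> 'b set \<Rightarrow> real" where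
  "per_on x A B = (\<Sum>f\<in>injs A B. \<Prod>t\<in>A. x (f t) t)"

text \<open>For \<open>card A \<le> card B\<close> there are
  \<open>fact (card B) / fact (card B - card A)\<close> injections, so this is the expectation of
  the product under a uniformly random one.\<close>

definition per_avg :: "('b \<Rightarrow> 'a \<Rightarrow> real) \<Rightarrow> 'a set \<Rightarrow> 'b set \<Rightarrow> real" where
  "per_avg x A B = fact (card B - card A) / fact (card B) * per_on x A B"

lemma finite_injs: "finite A \<Longrightarrow> finite B \<Longrightarrow> finite (injs A B)"
  by (rule finite_subset[of _ "A \<rightarrow>\<^sub>E B"]) (auto simp: injs_def intro: finite_PiE)

lemma injs_empty: "injs {} B = {\<lambda>_. undefined}"
  by (auto simp: injs_def)

lemma injs_mem: "f \<in> injs A B \<Longrightarrow> a \<in> A \<Longrightarrow> f a \<in> B"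
  by (auto simp: injs_def)

lemma card_injs_image: "f \<in> injs A B \<Longrightarrow> card (f ` A) = card A"
  by (auto simp: injs_def card_image)

text \<open>The values on \<open>A\<close> are chosen first; \<open>a\<close> then takes one of the
  rows still free.\<close>

lemma sum_injs_insert:
  fixes F :: "('a \<Rightarrow> 'b) \<Rightarrow> 'c::comm_monoid_add"
  assumes "a \<notin> A" "finite A" "finite B"
  shows "(\<Sum>f\<in>injs (insert a A) B. F f) = (\<Sum>f\<in>injs A B. \<Sum>b\<in>B - f ` A. F (f(a := b)))"
proof -
  have "(\<Sum>f\<in>injs A B. \<Sum>b\<in>B - f ` A. F (f(a := b)))
      = (\<Sum>(f, b)\<in>(SIGMA f:injs A B. B - f ` A). F (f(a := b)))"
    using assms by (intro sum.Sigma) (auto simp: finite_injs)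
  also have "\<dots> = (\<Sum>f\<in>injs (insert a A) B. F f)"
  \<comment> \<open>Restricting \<open>g\<close> to \<open>A\<close> means resetting it to
    \<open>undefined\<close> at \<open>a\<close>, as extensionality on \<open>A\<close>
    demands.\<close>
  proof (rule sum.reindex_bij_witness[where i = "\<lambda>g. (g(a := undefined), g a)"
        and j = "\<lambda>(f, b). f(a := b)"])
    fix g assume g: "g \<in> injs (insert a A) B"
    have "g(a := undefined) \<in> A \<rightarrow>\<^sub>E B"
      using g assms(1) by (auto simp: injs_def PiE_iff extensional_def)
    moreover have "inj_on (g(a := undefined)) A"
      using g assms(1) by (auto simp: injs_def inj_on_def)
    moreover have "g a \<in> B - g(a := undefined) ` A"
      using g assms(1) by (auto simp: injs_def inj_on_def)
    ultimately show "(g(a := undefined), g a) \<in> (SIGMA f:injs A B. B - f ` A)"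
      by (auto simp: injs_def)
  next
    fix p assume "p \<in> (SIGMA f:injs A B. B - f ` A)"
    then obtain f b where p: "p = (f, b)" "f \<in> injs A B" "b \<in> B" "b \<notin> f ` A" by auto
    have "f(a := b) \<in> insert a A \<rightarrow>\<^sub>E B"
      using p assms(1) by (auto simp: injs_def PiE_iff extensional_def)
    moreover have "inj_on (f(a := b)) (insert a A)"
      using p assms(1) by (auto simp: injs_def inj_on_def)
    ultimately show "(case p of (f, b) \<Rightarrow> f(a := b)) \<in> injs (insert a A) B"
      by (auto simp: injs_def p)
    have "f a = undefined" using p assms(1) by (auto simp: injs_def PiE_iff extensional_def)
    then show "((case p of (f, b) \<Rightarrow> f(a := b))(a := undefined),
        (case p of (f, b) \<Rightarrow> f(a := b)) a) = p"
      by (auto simp: p fun_eq_iff)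
  qed auto
  finally show ?thesis by simp
qed

text \<open>Here the row of \<open>a\<close> is chosen first and is then removed for the other
  columns; this order yields the expansion along a column.\<close>

lemma sum_injs_insert':
  fixes F :: "('a \<Rightarrow> 'b) \<Rightarrow> 'c::comm_monoid_add"
  assumes "a \<notin> A" "finite A" "finite B"
  shows "(\<Sum>f\<in>injs (insert a A) B. F f) = (\<Sum>b\<in>B. \<Sum>f\<in>injs A (B - {b}). F (f(a := b)))"
proof -
  have "(\<Sum>f\<in>injs (insert a A) B. F f) = (\<Sum>f\<in>injs A B. \<Sum>b\<in>B - f ` A. F (f(a := b)))"
    by (rule sum_injs_insert[OF assms])
  also have "\<dots> = (\<Sum>(f, b)\<in>(SIGMA f:injs A B. B - f ` A). F (f(a := b)))"
    using assms by (intro sum.Sigma) (auto simp: finite_injs)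
  also have "\<dots> = (\<Sum>(b, f)\<in>(SIGMA b:B. injs A (B - {b})). F (f(a := b)))"
    by (rule sum.reindex_bij_witness[where i = prod.swap and j = prod.swap])
      (auto simp: injs_def PiE_iff)
  also have "\<dots> = (\<Sum>b\<in>B. \<Sum>f\<in>injs A (B - {b}). F (f(a := b)))"
    using assms by (intro sum.Sigma[symmetric]) (auto simp: finite_injs)
  finally show ?thesis .
qed

lemma per_on_cong:
  assumes "\<And>b t. b \<in> B \<Longrightarrow> t \<in> A \<Longrightarrow> x b t = x' b t"
  shows "per_on x A B = per_on x' A B"
  unfolding per_on_def by (intro sum.cong prod.cong assms refl) (auto dest: injs_mem)

lemma per_on_nonneg:
  assumes "\<And>b t. b \<in> B \<Longrightarrow> t \<in> A \<Longrightarrow> 0 \<le> x b t"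
  shows "0 \<le> per_on x A B"
  unfolding per_on_def by (intro sum_nonneg prod_nonneg ballI assms) (auto dest: injs_mem)

lemma per_avg_empty: "per_avg x {} B = 1"
  by (simp add: per_avg_def per_on_def injs_empty)

lemma prod_fun_upd_insert:
  assumes "a \<notin> A" "finite A"
  shows "(\<Prod>t\<in>insert a A. x ((f(a := b)) t) t) = x b a * (\<Prod>t\<in>A. x (f t) (t::'a) :: real)"
proof -
  have "(\<Prod>t\<in>A. x ((f(a := b)) t) t) = (\<Prod>t\<in>A. x (f t) t)"
    using assms by (intro prod.cong) auto
  then show ?thesis using assms by simp
qed

text \<open>Laplace expansion along column \<open>a\<close>, with a weight on the row that
  \<open>a\<close> receives. The weight carries an entry of another column in the covariance
  identity and a logarithm in the Bregman-Minc proof.\<close>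

lemma per_on_insert_weight:
  assumes "a \<notin> A" "finite A" "finite B"
  shows "(\<Sum>f\<in>injs (insert a A) B. (\<Prod>t\<in>insert a A. x (f t) t) * g (f a))
       = (\<Sum>b\<in>B. x b a * per_on x A (B - {b}) * g b)"
  unfolding sum_injs_insert'[OF assms] prod_fun_upd_insert[OF assms(1,2)] per_on_def
  by (simp add: sum_distrib_left sum_distrib_right)

lemma per_on_insert:
  assumes "a \<notin> A" "finite A" "finite B"
  shows "per_on x (insert a A) B = (\<Sum>b\<in>B. x b a * per_on x A (B - {b}))"
  using per_on_insert_weight[OF assms, of x "\<lambda>_. 1"] by (simp add: per_on_def)

text \<open>Expansion in the other order: the sum over free rows is the column sum minus the
  collisions with rows already used.\<close>

lemma per_on_insert_avoid:
  assumes "a \<notin> A" "finite A" "finite B"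
  shows "per_on x (insert a A) B
    = (\<Sum>f\<in>injs A B. (\<Prod>t\<in>A. x (f t) t) * (\<Sum>b\<in>B - f ` A. x b a))"
  unfolding per_on_def sum_injs_insert[OF assms] prod_fun_upd_insert[OF assms(1,2)]
  by (simp add: sum_distrib_left mult.commute)

text \<open>Every injection of \<open>A\<close> has \<open>card B - card A\<close> extensions to
  \<open>a\<close>, and \<open>F\<close> does not see which one is taken.\<close>

lemma sum_injs_insert_const:
  fixes F :: "('a \<Rightarrow> 'b) \<Rightarrow> real"
  assumes "a \<notin> A" "finite A" "finite B"
    and F: "\<And>f b. f \<in> injs A B \<Longrightarrow> F (f(a := b)) = F f"
  shows "(\<Sum>f\<in>injs (insert a A) B. F f) = real (card B - card A) * (\<Sum>f\<in>injs A B. F f)"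
proof -
  have "(\<Sum>b\<in>B - f ` A. F (f(a := b))) = real (card B - card A) * F f" if "f \<in> injs A B" for f
  proof -
    have "card (B - f ` A) = card B - card A"
      using that assms by (subst card_Diff_subset) (auto simp: card_injs_image dest: injs_mem)
    then show ?thesis by (simp add: F[OF that])
  qed
  then show ?thesis by (simp add: sum_injs_insert[OF assms(1-3)] sum_distrib_left)
qed

text \<open>The number of possible extensions is exactly the factor by which the normalization
  changes.\<close>

lemma per_avg_insert_ones:
  assumes "a \<notin> A" "finite A" "finite B" "card A < card B" "\<And>b. b \<in> B \<Longrightarrow> x b a = 1"
  shows "per_avg x (insert a A) B = per_avg x A B"
proof -
  have "per_on x (insert a A) B = (\<Sum>f\<in>injs (insert a A) B. \<Prod>t\<in>A. x (f t) t)"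
    unfolding per_on_def using assms by (intro sum.cong) (auto dest: injs_mem)
  also have "\<dots> = real (card B - card A) * per_on x A B"
    unfolding per_on_def using assms
    by (intro sum_injs_insert_const) (auto intro!: prod.cong)
  finally have *: "per_on x (insert a A) B = real (card B - card A) * per_on x A B" .
  have "card B - card A = Suc (card B - card (insert a A))" using assms by simp
  then have "fact (card B - card A) = real (card B - card A) * fact (card B - card (insert a A))"
    by simp
  then show ?thesis unfolding per_avg_def * by simp
qed

lemma per_avg_union_ones:
  assumes "finite D" "finite A" "finite B" "A \<inter> D = {}" "card A + card D \<le> card B"
    and "\<And>b d. b \<in> B \<Longrightarrow> d \<in> D \<Longrightarrow> x b d = 1"
  shows "per_avg x (A \<union> D) B = per_avg x A B"
  using assms(1,4-6)
proof (induction D rule: finite_induct)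
  case (insert d D)
  have "card (A \<union> D) < card B"
    using insert card_Un_le[of A D] by simp
  then have "per_avg x (insert d (A \<union> D)) B = per_avg x (A \<union> D) B"
    using insert assms(2,3) by (intro per_avg_insert_ones) auto
  then show ?case using insert by simp
qed simp

text \<open>Exchanging the rows \<open>u\<close> and \<open>v\<close> antisymmetrizes the covariance term into a product of
  row differences.\<close>

lemma per_avg_insert_diff:
  fixes x :: "'b \<Rightarrow> 'a \<Rightarrow> real"
  assumes "r \<notin> A" "finite A" "finite B" "card A < card B"
  shows "per_avg x (insert r A) B - (\<Sum>b\<in>B. x b r) / card B * per_avg x A B
    = - (1 / (2 * card B)) * (\<Sum>s\<in>A. 1 / (real (card B) * (real (card B) - 1)) *
        (\<Sum>u\<in>B. \<Sum>v\<in>B - {u}. (x u r - x v r) * (x u s - x v s) * per_avg x (A - {s}) (B - {u, v})))"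
proof -
  define N where "N = card B"
  define k where "k = card A"
  define S where "S = (\<Sum>b\<in>B. x b r)"
  define T where "T s = (\<Sum>f\<in>injs A B. (\<Prod>t\<in>A. x (f t) t) * x (f s) r)" for s
  define w where "w s u v = per_on x (A - {s}) (B - {u, v})" for s u v
  have kN: "k < N" using assms by (simp add: k_def N_def)
  \<comment> \<open>\<open>T s\<close> collects the collisions in which column \<open>r\<close>
    would reuse the row of column \<open>s\<close>; injectivity makes these cases disjoint.\<close>
  have W: "per_on x (insert r A) B = S * per_on x A B - (\<Sum>s\<in>A. T s)"
  proof -
    have "(\<Sum>b\<in>B - f ` A. x b r) = S - (\<Sum>s\<in>A. x (f s) r)" if "f \<in> injs A B" for f
    proof -
      have "f ` A \<subseteq> B" "inj_on f A" using that by (auto simp: injs_def)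
      then show ?thesis unfolding S_def
        by (subst sum_diff) (auto simp: assms sum.reindex)
    qed
    then have "per_on x (insert r A) B
      = (\<Sum>f\<in>injs A B. (\<Prod>t\<in>A. x (f t) t) * (S - (\<Sum>s\<in>A. x (f s) r)))"
      unfolding per_on_insert_avoid[OF assms(1-3)] by (intro sum.cong) auto
    also have "\<dots> = S * per_on x A B - (\<Sum>f\<in>injs A B. \<Sum>s\<in>A. (\<Prod>t\<in>A. x (f t) t) * x (f s) r)"
    proof -
      have "(\<Prod>t\<in>A. x (f t) t) * (S - (\<Sum>s\<in>A. x (f s) r))
        = S * (\<Prod>t\<in>A. x (f t) t) - (\<Sum>s\<in>A. (\<Prod>t\<in>A. x (f t) t) * x (f s) r)" for f
        unfolding right_diff_distrib sum_distrib_left[symmetric] by simp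
      then show ?thesis unfolding per_on_def sum_subtractf[symmetric] sum_distrib_left by simp
    qed
    also have "(\<Sum>f\<in>injs A B. \<Sum>s\<in>A. (\<Prod>t\<in>A. x (f t) t) * x (f s) r) = (\<Sum>s\<in>A. T s)"
      unfolding T_def by (rule sum.swap)
    finally show ?thesis .
  qed
  \<comment> \<open>Both terms are expanded over the same ordered pairs of rows \<open>u\<close>,
    \<open>v\<close> with the same smaller permanent \<open>w s u v\<close>, so that only the
    entries of columns \<open>r\<close> and \<open>s\<close> differ.\<close>
  have swap: "per_on x (insert r A) B - (real N - real k) * T s
      = - (1 / 2) * (\<Sum>u\<in>B. \<Sum>v\<in>B - {u}. (x u r - x v r) * (x u s - x v s) * w s u v)"
    if s: "s \<in> A" for s
  proof -
    define K where "K = A - {s}"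
    have K: "s \<notin> K" "finite K" "A = insert s K" "r \<notin> K" "r \<noteq> s"
      using s assms by (auto simp: K_def)
    have w_eq: "per_on x K (B - {u} - {v}) = w s u v" for u v
      by (simp add: w_def K_def Diff_insert2[symmetric] insert_commute)
    have wsym: "w s u v = w s v u" for u v by (simp add: w_def insert_commute)
    have sw: "(\<Sum>u\<in>B. \<Sum>v\<in>B - {u}. h u v) = (\<Sum>u\<in>B. \<Sum>v\<in>B - {u}. h v u)" for h :: "'b \<Rightarrow> 'b \<Rightarrow> real"
    proof -
      have "(\<Sum>u\<in>B. \<Sum>v\<in>B - {u}. h u v) = (\<Sum>u\<in>B. \<Sum>v\<in>B. if u \<noteq> v then h u v else 0)" for h :: "'b \<Rightarrow> 'b \<Rightarrow> real"
        using assms by (intro sum.cong sum.mono_neutral_cong_left) auto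
      note * = this
      show ?thesis unfolding * by (subst sum.swap) (intro sum.cong, auto)
    qed
    have e1: "per_on x (insert r A) B = (\<Sum>u\<in>B. \<Sum>v\<in>B - {u}. x u r * x v s * w s u v)"
    proof -
      have "per_on x (insert r A) B = (\<Sum>u\<in>B. x u r * per_on x A (B - {u}))"
        using assms(1-3) by (rule per_on_insert)
      moreover have "per_on x A (B - {u}) = (\<Sum>v\<in>B - {u}. x v s * w s u v)" for u
        using per_on_insert[of s K "B - {u}" x] K(1,2) assms(3)
        by (simp add: w_eq flip: K(3))
      ultimately show ?thesis by (simp add: sum_distrib_left mult.assoc)
    qed
    \<comment> \<open>The factor \<open>N - k\<close> counts the free rows \<open>u\<close> that a
      phantom column \<open>r\<close> could take. Column \<open>s\<close> sits in row
      \<open>v\<close>, which also supplies the entry of column \<open>r\<close>.\<close>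
    have e2: "(real N - real k) * T s = (\<Sum>u\<in>B. \<Sum>v\<in>B - {u}. x v r * x v s * w s u v)"
    proof -
      have "(real N - real k) * T s
        = (\<Sum>f\<in>injs (insert r A) B. (\<Prod>t\<in>A. x (f t) t) * x (f s) r)"
        unfolding T_def using assms kN s
        by (subst sum_injs_insert_const)
          (auto simp: N_def k_def of_nat_diff intro!: arg_cong2[where f = "(*)"] prod.cong)
      also have "\<dots> = (\<Sum>u\<in>B. \<Sum>f\<in>injs A (B - {u}). (\<Prod>t\<in>A. x (f t) t) * x (f s) r)"
        unfolding sum_injs_insert'[OF assms(1-3)] using assms s
        by (auto intro!: sum.cong arg_cong2[where f = "(*)"] prod.cong)
      finally have "(real N - real k) * T s
        = (\<Sum>u\<in>B. \<Sum>f\<in>injs A (B - {u}). (\<Prod>t\<in>A. x (f t) t) * x (f s) r)" .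
      moreover have "(\<Sum>f\<in>injs A (B - {u}). (\<Prod>t\<in>A. x (f t) t) * x (f s) r)
        = (\<Sum>v\<in>B - {u}. x v r * x v s * w s u v)" for u
        using per_on_insert_weight[of s K "B - {u}" x "\<lambda>v. x v r"] K(1,2) assms(3)
        by (simp add: w_eq mult_ac flip: K(3))
      ultimately show ?thesis by simp
    qed
    \<comment> \<open>The difference is written twice and \<open>u\<close>, \<open>v\<close> are
      exchanged in the second copy; \<open>w s u v\<close> is symmetric, so the product of
      differences appears.\<close>
    have "2 * (per_on x (insert r A) B - (real N - real k) * T s)
      = (\<Sum>u\<in>B. \<Sum>v\<in>B - {u}. (x u r - x v r) * x v s * w s u v)
      + (\<Sum>u\<in>B. \<Sum>v\<in>B - {u}. (x u r - x v r) * x v s * w s u v)"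
      unfolding e1 e2 by (simp add: algebra_simps sum_subtractf)
    also have "\<dots> = (\<Sum>u\<in>B. \<Sum>v\<in>B - {u}. (x u r - x v r) * x v s * w s u v)
      + (\<Sum>u\<in>B. \<Sum>v\<in>B - {u}. (x v r - x u r) * x u s * w s u v)"
      by (subst (2) sw) (simp add: wsym)
    also have "\<dots> = - (\<Sum>u\<in>B. \<Sum>v\<in>B - {u}. (x u r - x v r) * (x u s - x v s) * w s u v)"
      unfolding sum.distrib[symmetric] sum_negf[symmetric]
      by (intro sum.cong refl) (simp add: algebra_simps)
    finally show ?thesis by simp
  qed
  have c: "fact (N - k) = (real N - real k) * fact (N - Suc k)"
  proof -
    have "N - k = Suc (N - Suc k)" using kN by simp
    then show ?thesis using kN by (simp add: of_nat_diff)
  qed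
  define Y where "Y s = (\<Sum>u\<in>B. \<Sum>v\<in>B - {u}. (x u r - x v r) * (x u s - x v s) * w s u v)" for s
  have avg: "1 / (real N * (real N - 1)) *
      (\<Sum>u\<in>B. \<Sum>v\<in>B - {u}. (x u r - x v r) * (x u s - x v s) * per_avg x (A - {s}) (B - {u, v}))
    = fact (N - Suc k) / fact N * Y s" if s: "s \<in> A" for s
  proof -
    have k1: "1 \<le> k" using s assms by (auto simp: k_def Suc_le_eq card_gt_0_iff)
    have fact_N: "fact N = real N * (real N - 1) * fact (N - 2)"
    proof -
      have "N = Suc (Suc (N - 2))" using kN k1 by simp
      then have "fact N = real N * (real (N - 1) * fact (N - 2))"
        by (metis fact_Suc of_nat_mult of_nat_fact diff_Suc_1)
      then show ?thesis using kN k1 by (simp add: of_nat_diff)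
    qed
    have "per_avg x (A - {s}) (B - {u, v}) = fact (N - Suc k) / fact (N - 2) * w s u v"
      if "u \<in> B" "v \<in> B - {u}" for u v
    proof -
      have "card {u, v} = 2" using that by auto
      then have "card (B - {u, v}) = N - 2" using that assms by (simp add: N_def card_Diff_subset)
      moreover have "card (A - {s}) = k - 1" using s assms by (simp add: k_def)
      moreover have "N - 2 - (k - 1) = N - Suc k" using k1 by simp
      ultimately show ?thesis by (simp add: per_avg_def w_def)
    qed
    then have "(\<Sum>u\<in>B. \<Sum>v\<in>B - {u}. (x u r - x v r) * (x u s - x v s) * per_avg x (A - {s}) (B - {u, v}))
      = fact (N - Suc k) / fact (N - 2) * Y s"
      unfolding Y_def sum_distrib_left by (intro sum.cong refl) simp
    then show ?thesis unfolding fact_N by simp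
  qed
  have "card (insert r A) = Suc k" using assms by (simp add: k_def)
  then have "real N * (per_avg x (insert r A) B - S / N * per_avg x A B)
    = fact (N - Suc k) / fact N *
      (real N * per_on x (insert r A) B - (real N - real k) * (S * per_on x A B))"
    using kN unfolding per_avg_def N_def[symmetric] k_def[symmetric] c
    by (simp add: field_simps)
  \<comment> \<open>Since \<open>A\<close> has \<open>k\<close> elements, the right-hand side
    contains \<open>k\<close> copies of the large permanent; the remaining \<open>N - k\<close> come
    from replacing the sum of all \<open>T s\<close> by means of \<open>W\<close>.\<close>
  also have "real N * per_on x (insert r A) B - (real N - real k) * (S * per_on x A B)
    = (\<Sum>s\<in>A. per_on x (insert r A) B - (real N - real k) * T s)"
    unfolding sum_subtractf sum_distrib_left[symmetric] W by (simp add: k_def algebra_simps)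
  also have "\<dots> = (\<Sum>s\<in>A. - (1 / 2) * Y s)"
    using swap by (intro sum.cong) (auto simp: Y_def)
  also have "\<dots> = - (1 / 2) * sum Y A" by (rule sum_distrib_left[symmetric])
  finally have "per_avg x (insert r A) B - S / N * per_avg x A B
    = - (1 / (2 * N)) * (fact (N - Suc k) / fact N * sum Y A)"
    using kN by (simp add: field_simps)
  also have "fact (N - Suc k) / fact N * sum Y A = (\<Sum>s\<in>A. fact (N - Suc k) / fact N * Y s)"
    by (rule sum_distrib_left)
  also have "(\<Sum>s\<in>A. fact (N - Suc k) / fact N * Y s)
    = (\<Sum>s\<in>A. 1 / (real N * (real N - 1)) *
      (\<Sum>u\<in>B. \<Sum>v\<in>B - {u}. (x u r - x v r) * (x u s - x v s) * per_avg x (A - {s}) (B - {u, v})))"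
    by (rule sum.cong[OF refl avg[symmetric]])
  finally show ?thesis unfolding N_def S_def .
qed

section \<open>The Bregman-Minc inequality\<close>

text \<open>The tangent at \<open>y\<close> lies below the convex function \<open>x * ln x\<close>.
  Summed with \<open>y\<close> equal to the mean, its linear terms cancel, which gives Jensen's
  inequality including the case \<open>x = 0\<close>.\<close>

lemma x_ln_x_ge:
  fixes x y :: real
  assumes "0 \<le> x" "0 < y"
  shows "x * ln y + (x - y) \<le> x * ln x"
proof (cases "x = 0")
  case False
  then have x: "x > 0" using assms by simp
  have "ln (y / x) \<le> y / x - 1" using x assms by (intro ln_le_minus_one) simp
  then have "x * (ln y - ln x) \<le> x * (y / x - 1)"
    using x assms by (intro mult_left_mono) (auto simp: ln_div)
  then show ?thesis using x by (simp add: algebra_simps)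
qed (use assms in simp)

text \<open>Schrijver's proof: convexity of \<open>p ln p\<close> for the expansion along every column, averaged over
  the permutations that contribute to the permanent.\<close>

lemma bregman_minc_ln:
  fixes R :: "'a \<Rightarrow> 'b set"
  defines "x \<equiv> (\<lambda>b t. of_bool (b \<in> R t))"
  assumes "finite I" "finite J" "card I = card J" "0 < per_on x I J"
  shows "ln (per_on x I J) \<le> (\<Sum>i\<in>I. ln (fact (card (R i \<inter> J))) / real (card (R i \<inter> J)))"
  using assms(2-5)
proof (induction "card I" arbitrary: I J)
  case 0
  then have "I = {}" by simp
  then show ?case by (simp add: per_on_def injs_empty)
next
  case (Suc m)
  define L where "L c = ln (fact c :: real) / real c" for c :: nat
  define M where "M = card I"
  define p where "p = per_on x I J"
  define q where "q i k = per_on x (I - {i}) (J - {k})" for i k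
  define w where "w f = (\<Prod>t\<in>I. x (f t) t)" for f
  define r where "r i = card (R i \<inter> J)" for i
  have M: "M > 0" "M = card J" using Suc by (auto simp: M_def)
  have p: "p > 0" using Suc by (simp add: p_def)
  have psum: "p = (\<Sum>f\<in>injs I J. w f)" by (simp add: p_def per_on_def w_def)
  have w0: "w f \<ge> 0" for f by (simp add: w_def x_def prod_nonneg)
  have q0: "q i k \<ge> 0" for i k unfolding q_def by (intro per_on_nonneg) (simp add: x_def)
  \<comment> \<open>Translates between sums over minors along column \<open>i\<close> and sums over
    injections; rows outside \<open>R i\<close> contribute zero.\<close>
  have weight: "(\<Sum>f\<in>injs I J. w f * g (f i)) = (\<Sum>k\<in>R i \<inter> J. q i k * g k)"
    if i: "i \<in> I" for i and g :: "'b \<Rightarrow> real"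
  proof -
    have I: "I = insert i (I - {i})" using i by auto
    have "(\<Sum>f\<in>injs I J. w f * g (f i)) = (\<Sum>k\<in>J. x k i * q i k * g k)"
      unfolding w_def q_def using per_on_insert_weight[of i "I - {i}" J x g] Suc I[symmetric] by simp
    also have "\<dots> = (\<Sum>k\<in>R i \<inter> J. q i k * g k)"
      using Suc by (intro sum.mono_neutral_cong_right) (auto simp: x_def)
    finally show ?thesis .
  qed
  have rpos: "r i > 0" if i: "i \<in> I" for i
  proof (rule ccontr)
    assume "\<not> r i > 0"
    then have "R i \<inter> J = {}" using Suc by (auto simp: r_def)
    then have "p = 0" using weight[OF i, of "\<lambda>_. 1"] psum by simp
    then show False using p by simp
  qed
  \<comment> \<open>The minors \<open>q i k\<close> with \<open>k\<close> in
    \<open>R i \<inter> J\<close> sum to \<open>p\<close>, so their mean is \<open>p / r i\<close>;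
    the tangent inequality is applied at this point.\<close>
  have step: "p * ln p \<le> (\<Sum>f\<in>injs I J. w f * (ln (r i) + ln (q i (f i))))" if i: "i \<in> I" for i
  proof -
    have pq: "(\<Sum>k\<in>R i \<inter> J. q i k) = p" using weight[OF i, of "\<lambda>_. 1"] psum by simp
    have "p * ln (p / r i) = (\<Sum>k\<in>R i \<inter> J. q i k * ln (p / r i) + (q i k - p / r i))"
      using rpos[OF i] by (simp add: sum.distrib sum_subtractf pq sum_distrib_right[symmetric] r_def)
    also have "\<dots> \<le> (\<Sum>k\<in>R i \<inter> J. q i k * ln (q i k))"
      using p rpos[OF i] q0 by (intro sum_mono x_ln_x_ge) auto
    finally have "p * ln p \<le> p * ln (r i) + (\<Sum>k\<in>R i \<inter> J. q i k * ln (q i k))"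
      using p rpos[OF i] by (simp add: ln_div algebra_simps)
    also have "(\<Sum>k\<in>R i \<inter> J. q i k * ln (q i k)) = (\<Sum>f\<in>injs I J. w f * ln (q i (f i)))"
      using weight[OF i, of "\<lambda>k. ln (q i k)"] by simp
    finally show ?thesis
      by (simp add: psum distrib_left sum.distrib flip: sum_distrib_right)
  qed
  have inner: "(\<Sum>i\<in>I. ln (r i) + ln (q i (f i))) \<le> M * (\<Sum>i\<in>I. L (r i))"
    if f: "f \<in> injs I J" and wf: "w f \<noteq> 0" for f
  proof -
    have bij: "bij_betw f I J"
    proof -
      have "inj_on f I" "f ` I \<subseteq> J" using f by (auto simp: injs_def)
      then show ?thesis using Suc by (simp add: bij_betw_def card_image card_subset_eq)
    qed
    have fR: "f i \<in> R i" if "i \<in> I" for i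
    proof -
      have "x (f i) i \<noteq> 0" using wf that Suc by (simp add: w_def)
      then show ?thesis by (simp add: x_def)
    qed
    \<comment> \<open>The induction hypothesis applies to the minor because the restriction of
      \<open>f\<close> contributes 1 to it, so the minor is positive.\<close>
    have "ln (q i (f i)) \<le> (\<Sum>j\<in>I - {i}. L (card (R j \<inter> (J - {f i}))))" if i: "i \<in> I" for i
    proof -
      let ?f = "f(i := undefined)"
      have "?f \<in> injs (I - {i}) (J - {f i})"
        using f i by (auto simp: injs_def PiE_iff extensional_def inj_on_def)
      moreover have "(\<Prod>t\<in>I - {i}. x (?f t) t) = 1"
        using fR by (intro prod.neutral) (auto simp: x_def)
      moreover have "(\<Prod>t\<in>I - {i}. x (?f t) t) \<le> q i (f i)" if "?f \<in> injs (I - {i}) (J - {f i})"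
        unfolding q_def per_on_def using Suc
        by (intro member_le_sum[OF that]) (auto simp: x_def finite_injs intro!: prod_nonneg)
      ultimately have "1 \<le> q i (f i)" by simp
      moreover have "f i \<in> J" using f i by (rule injs_mem)
      ultimately show ?thesis
        unfolding q_def L_def using Suc i by (intro Suc(1)) auto
    qed
    then have "(\<Sum>i\<in>I. ln (r i) + ln (q i (f i)))
      \<le> (\<Sum>i\<in>I. ln (r i)) + (\<Sum>i\<in>I. \<Sum>j\<in>I - {i}. L (card (R j \<inter> (J - {f i}))))"
      unfolding sum.distrib by (intro add_left_mono sum_mono)
    also have "(\<Sum>i\<in>I. \<Sum>j\<in>I - {i}. L (card (R j \<inter> (J - {f i}))))
      = (\<Sum>j\<in>I. \<Sum>i\<in>I - {j}. L (card (R j \<inter> (J - {f i}))))"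
    proof -
      have *: "(\<Sum>i\<in>I. \<Sum>j\<in>I - {i}. h i j) = (\<Sum>i\<in>I. \<Sum>j\<in>I. if i \<noteq> j then h i j else 0)" for h :: "'a \<Rightarrow> 'a \<Rightarrow> real"
        using Suc by (intro sum.cong sum.mono_neutral_cong_left) auto
      show ?thesis unfolding * by (subst sum.swap) (intro sum.cong, auto)
    qed
    also have "(\<Sum>i\<in>I. ln (r i)) + \<dots>
      = (\<Sum>j\<in>I. ln (r j) + (\<Sum>i\<in>I - {j}. L (card (R j \<inter> (J - {f i})))))"
      by (simp add: sum.distrib)
    \<comment> \<open>For fixed \<open>j\<close>, deleting row \<open>f i\<close> lowers the count
      of column \<open>j\<close> by one for \<open>r j - 1\<close> of the indices
      \<open>i \<noteq> j\<close> and leaves it unchanged for the other \<open>M - r j\<close>. The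
      logarithm of \<open>r j\<close> then completes the smaller factorial to
      \<open>fact (r j)\<close>.\<close>
    also have "\<dots> = (\<Sum>j\<in>I. M * L (r j))"
    proof (intro sum.cong refl)
      fix j assume j: "j \<in> I"
      have fj: "f j \<in> R j \<inter> J" using fR j injs_mem[OF f] by auto
      have "bij_betw f (I - {j}) (J - {f j})"
        using bij j by (auto simp: bij_betw_def inj_on_def)
      then have "(\<Sum>i\<in>I - {j}. L (card (R j \<inter> (J - {f i}))))
        = (\<Sum>k\<in>J - {f j}. L (card (R j \<inter> (J - {k}))))"
        by (rule sum.reindex_bij_betw)
      also have "\<dots> = (\<Sum>k\<in>R j \<inter> J - {f j}. L (card (R j \<inter> (J - {k}))))
         + (\<Sum>k\<in>J - R j. L (card (R j \<inter> (J - {k}))))"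
        using Suc fj by (subst sum.union_disjoint[symmetric]) (auto intro!: sum.cong)
      also have "(\<Sum>k\<in>R j \<inter> J - {f j}. L (card (R j \<inter> (J - {k})))) = real (r j - 1) * L (r j - 1)"
      proof -
        have "L (card (R j \<inter> (J - {k}))) = L (r j - 1)" if "k \<in> R j \<inter> J - {f j}" for k
        proof -
          have "R j \<inter> (J - {k}) = R j \<inter> J - {k}" by auto
          then show ?thesis using that Suc by (simp add: r_def)
        qed
        then show ?thesis using fj Suc by (simp add: r_def)
      qed
      also have "(\<Sum>k\<in>J - R j. L (card (R j \<inter> (J - {k})))) = real (M - r j) * L (r j)"
      proof -
        have "L (card (R j \<inter> (J - {k}))) = L (r j)" if "k \<in> J - R j" for k
        proof -
          have "R j \<inter> (J - {k}) = R j \<inter> J" using that by auto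
          then show ?thesis by (simp add: r_def)
        qed
        moreover have "card (J - R j) = M - r j"
          using Suc by (simp add: M r_def Int_commute card_Diff_subset_Int)
        ultimately show ?thesis by simp
      qed
      finally have *: "(\<Sum>i\<in>I - {j}. L (card (R j \<inter> (J - {f i}))))
        = real (r j - 1) * L (r j - 1) + real (M - r j) * L (r j)" .
      \<comment> \<open>For \<open>r j = 1\<close> both sides are 0.\<close>
      have "real (r j - 1) * L (r j - 1) = ln (fact (r j - 1))"
        by (cases "r j - 1") (simp_all add: L_def del: fact_Suc)
      moreover have "ln (real (r j)) + ln (fact (r j - 1)) = ln (fact (r j))"
        using rpos[OF j] by (subst fact_reduce[of "r j"]) (auto simp: ln_mult)
      moreover have "ln (fact (r j)) = real (r j) * L (r j)"
        using rpos[OF j] by (simp add: L_def)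
      moreover have "r j \<le> M" unfolding r_def M using Suc by (intro card_mono) auto
      ultimately show "ln (r j) + (\<Sum>i\<in>I - {j}. L (card (R j \<inter> (J - {f i})))) = M * L (r j)"
        unfolding * by (simp add: of_nat_diff algebra_simps)
    qed
    finally show ?thesis by (simp add: sum_distrib_left)
  qed
  have "M * (p * ln p) = (\<Sum>i\<in>I. p * ln p)" by (simp add: M_def)
  also have "\<dots> \<le> (\<Sum>i\<in>I. \<Sum>f\<in>injs I J. w f * (ln (r i) + ln (q i (f i))))"
    by (intro sum_mono step)
  also have "\<dots> = (\<Sum>f\<in>injs I J. w f * (\<Sum>i\<in>I. ln (r i) + ln (q i (f i))))"
    by (subst sum.swap) (simp add: sum_distrib_left)
  \<comment> \<open>The bound \<open>inner\<close> concerns contributing injections only; all others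
    have weight zero.\<close>
  also have "\<dots> \<le> (\<Sum>f\<in>injs I J. w f * (M * (\<Sum>i\<in>I. L (r i))))"
  proof (intro sum_mono)
    fix f assume "f \<in> injs I J"
    then show "w f * (\<Sum>i\<in>I. ln (r i) + ln (q i (f i))) \<le> w f * (M * (\<Sum>i\<in>I. L (r i)))"
      using inner[of f] w0 by (cases "w f = 0") (auto intro!: mult_left_mono)
  qed
  also have "\<dots> = M * (p * (\<Sum>i\<in>I. L (r i)))"
    unfolding psum sum_distrib_right[symmetric] by simp
  finally have "ln p \<le> (\<Sum>i\<in>I. L (r i))" using M p by simp
  then show ?case by (simp add: p_def L_def r_def)
qed

lemma zeta_nonneg: "0 \<le> zeta k"
  by (simp add: zeta_def)

lemma bregman_minc:
  fixes R :: "'a \<Rightarrow> 'b set"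
  defines "x \<equiv> (\<lambda>b t. of_bool (b \<in> R t))"
  assumes "finite I" "finite J" "card I = card J"
  shows "per_on x I J \<le> (\<Prod>i\<in>I. zeta (card (R i \<inter> J)))"
proof (cases "per_on x I J > 0")
  case True
  \<comment> \<open>A column without ones would contribute \<open>exp 0 = 1\<close> to the
    logarithmic bound, whereas \<open>zeta 0 = 0\<close>; a positive permanent excludes such
    columns.\<close>
  have pos: "card (R i \<inter> J) \<noteq> 0" if i: "i \<in> I" for i
  proof
    assume "card (R i \<inter> J) = 0"
    then have "R i \<inter> J = {}" using assms by simp
    then have "per_on x I J = 0"
      unfolding per_on_def using i assms(2)
      by (intro sum.neutral) (auto simp: x_def intro!: bexI[of _ i] dest: injs_mem)
    with True show False by simp
  qed
  have "per_on x I J = exp (ln (per_on x I J))" using True by simp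
  also have "\<dots> \<le> exp (\<Sum>i\<in>I. ln (fact (card (R i \<inter> J))) / real (card (R i \<inter> J)))"
    using bregman_minc_ln[OF assms(2-4), of R] True unfolding exp_le_cancel_iff x_def by blast
  also have "\<dots> = (\<Prod>i\<in>I. zeta (card (R i \<inter> J)))"
    unfolding exp_sum[OF assms(2)] using pos
    by (intro prod.cong refl) (simp add: zeta_def powr_def)
  finally show ?thesis .
next
  case False
  then show ?thesis using prod_nonneg[of I "\<lambda>i. zeta (card (R i \<inter> J))"] zeta_nonneg
    by (metis not_less order_trans)
qed

text \<open>The rectangular case follows by adding columns of ones, which do not change the average.\<close>

lemma per_avg_le_prod_zeta:
  fixes z :: "'b \<Rightarrow> nat \<Rightarrow> nat"
  assumes fin: "finite K" "finite B" and card: "card K \<le> card B"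
    and z: "\<And>b t. b \<in> B \<Longrightarrow> t \<in> K \<Longrightarrow> z b t \<in> {0, 1}"
  shows "per_avg (\<lambda>b t. real (z b t)) K B
    \<le> (\<Prod>t\<in>K. zeta (\<Sum>b\<in>B. z b t) / fact (card B) powr (1 / card B))"
proof (cases "card B = 0")
  case True
  then show ?thesis using assms by (simp add: per_avg_empty)
next
  case False
  define M where "M = card B"
  obtain D where D: "finite D" "card D = M - card K" "D \<inter> K = {}"
    using finite_arbitrarily_large_disj[of K "M - card K"] fin by auto
  define R where "R t = (if t \<in> K then {b. z b t = 1} else UNIV)" for t
  define x :: "'b \<Rightarrow> nat \<Rightarrow> real" where "x = (\<lambda>b t. of_bool (b \<in> R t))"
  have cKD: "card (K \<union> D) = M" using D fin card by (subst card_Un_disjoint) (auto simp: M_def)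
  have xz: "x b t = real (z b t)" if "b \<in> B" "t \<in> K" for b t
    using z[OF that] that by (auto simp: x_def R_def)
  have RK: "card (R t \<inter> B) = (\<Sum>b\<in>B. z b t)" if t: "t \<in> K" for t
  proof -
    have "(\<Sum>b\<in>B. z b t) = (\<Sum>b\<in>B. of_bool (b \<in> R t))"
      using z t by (intro sum.cong) (auto simp: R_def)
    also have "\<dots> = card (R t \<inter> B)" using fin by (simp add: Int_commute)
    finally show ?thesis by simp
  qed
  have "per_avg (\<lambda>b t. real (z b t)) K B = per_avg x K B"
    unfolding per_avg_def using xz by (intro arg_cong2[where f = "(*)"] per_on_cong) auto
  also have "\<dots> = per_avg x (K \<union> D) B"
    using fin D card by (intro per_avg_union_ones[symmetric]) (auto simp: x_def R_def M_def)
  also have "\<dots> = per_on x (K \<union> D) B / fact M"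
    unfolding per_avg_def using cKD by (simp add: M_def)
  also have "\<dots> \<le> (\<Prod>t\<in>K \<union> D. zeta (card (R t \<inter> B))) / fact M"
    unfolding x_def using fin D cKD by (intro divide_right_mono bregman_minc) (auto simp: M_def)
  also have "(\<Prod>t\<in>K \<union> D. zeta (card (R t \<inter> B))) = (\<Prod>t\<in>K. zeta (\<Sum>b\<in>B. z b t)) * zeta M ^ (M - card K)"
  proof -
    have "(\<Prod>t\<in>D. zeta (card (R t \<inter> B))) = (\<Prod>t\<in>D. zeta M)"
      using D by (intro prod.cong) (auto simp: R_def M_def)
    then show ?thesis using fin D RK by (subst prod.union_disjoint) auto
  qed
  \<comment> \<open>As \<open>zeta M ^ M = fact M\<close>, the factors of the columns of ones cancel
    against the factorial and leave one \<open>zeta M\<close> in the denominator for each column of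
    \<open>K\<close>.\<close>
  also have "\<dots> / fact M = (\<Prod>t\<in>K. zeta (\<Sum>b\<in>B. z b t)) / zeta M ^ card K"
  proof -
    have "zeta M ^ M = fact M" using False by (simp add: zeta_def M_def powr_powr flip: powr_realpow)
    then have "fact M = zeta M ^ (M - card K) * zeta M ^ card K"
      using card by (simp add: M_def flip: power_add)
    moreover have "zeta M \<noteq> 0" using False by (simp add: zeta_def M_def)
    ultimately show ?thesis by simp
  qed
  also have "\<dots> = (\<Prod>t\<in>K. zeta (\<Sum>b\<in>B. z b t) / fact (card B) powr (1 / card B))"
    using False by (simp add: prod_dividef zeta_def M_def)
  finally show ?thesis .
qed

section \<open>Maclaurin's inequality\<close>

definition ksubsets :: "'a set \<Rightarrow> nat \<Rightarrow> 'a set set" where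
  "ksubsets S k = {A. A \<subseteq> S \<and> card A = k}"

lemma finite_ksubsets: "finite S \<Longrightarrow> finite (ksubsets S k)"
  by (simp add: ksubsets_def)

lemma ksubsets_0: "finite S \<Longrightarrow> ksubsets S 0 = {{}}"
  by (auto simp: ksubsets_def dest: finite_subset)

lemma ksubsets_card: "finite S \<Longrightarrow> ksubsets S (card S) = {S}"
  by (auto simp: ksubsets_def dest: card_subset_eq)

text \<open>Double counting: a \<open>k\<close>-set with a point outside it is the same as a set of
  size \<open>Suc k\<close> with a marked point.\<close>

lemma sum_ksubsets_insert:
  fixes G :: "'a set \<Rightarrow> 'a \<Rightarrow> 'c::comm_monoid_add"
  assumes S: "finite S"
  shows "(\<Sum>A\<in>ksubsets S k. \<Sum>b\<in>S - A. G A b) = (\<Sum>A\<in>ksubsets S (Suc k). \<Sum>b\<in>A. G (A - {b}) b)"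
proof -
  have fin: "finite A" if "A \<in> ksubsets S j" for A j
    using that S by (auto simp: ksubsets_def intro: finite_subset)
  have "(\<Sum>A\<in>ksubsets S k. \<Sum>b\<in>S - A. G A b) = (\<Sum>(A, b)\<in>(SIGMA A:ksubsets S k. S - A). G A b)"
    using S by (intro sum.Sigma) (auto simp: finite_ksubsets)
  also have "\<dots> = (\<Sum>(A, b)\<in>(SIGMA A:ksubsets S (Suc k). A). G (A - {b}) b)"
    by (rule sum.reindex_bij_witness[where i = "\<lambda>(A, b). (A - {b}, b)" and j = "\<lambda>(A, b). (insert b A, b)"])
      (auto simp: ksubsets_def card_Diff_singleton_if card_insert_if dest: finite_subset[OF _ S])
  also have "\<dots> = (\<Sum>A\<in>ksubsets S (Suc k). \<Sum>b\<in>A. G (A - {b}) b)"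
    using S by (intro sum.Sigma[symmetric]) (auto simp: finite_ksubsets fin)
  finally show ?thesis .
qed

lemma sum_ksubsets_swap:
  fixes G :: "'a set \<Rightarrow> 'a \<Rightarrow> 'c::comm_monoid_add"
  assumes S: "finite S"
  shows "(\<Sum>b\<in>S. \<Sum>A\<in>ksubsets (S - {b}) k. G A b) = (\<Sum>A\<in>ksubsets S k. \<Sum>b\<in>S - A. G A b)"
proof -
  have "(\<Sum>b\<in>S. \<Sum>A\<in>ksubsets (S - {b}) k. G A b) = (\<Sum>(b, A)\<in>(SIGMA b:S. ksubsets (S - {b}) k). G A b)"
    using S by (intro sum.Sigma) (auto simp: finite_ksubsets)
  also have "\<dots> = (\<Sum>(A, b)\<in>(SIGMA A:ksubsets S k. S - A). G A b)"
    by (rule sum.reindex_bij_witness[where i = prod.swap and j = prod.swap])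
      (auto simp: ksubsets_def)
  also have "\<dots> = (\<Sum>A\<in>ksubsets S k. \<Sum>b\<in>S - A. G A b)"
    using S by (intro sum.Sigma[symmetric]) (auto simp: finite_ksubsets)
  finally show ?thesis .
qed

text \<open>Moves the choice of the two special columns outside the choice of the set, or
  back.\<close>

lemma sum_ksubsets_swap2:
  fixes G :: "'a set \<Rightarrow> 'a \<Rightarrow> 'a \<Rightarrow> 'c::comm_monoid_add"
  assumes S: "finite S"
  shows "(\<Sum>s\<in>S. \<Sum>r\<in>S - {s}. \<Sum>A\<in>ksubsets (S - {s, r}) k. G A s r)
    = (\<Sum>A\<in>ksubsets S k. \<Sum>s\<in>S - A. \<Sum>r\<in>S - insert s A. G A s r)"
proof -
  have "(\<Sum>r\<in>S - {s}. \<Sum>A\<in>ksubsets (S - {s, r}) k. G A s r)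
    = (\<Sum>A\<in>ksubsets (S - {s}) k. \<Sum>r\<in>S - insert s A. G A s r)" for s
    using sum_ksubsets_swap[of "S - {s}" "\<lambda>A r. G A s r" k] S
    by (simp add: Diff_insert2[symmetric])
  then show ?thesis using sum_ksubsets_swap[OF S] by simp
qed

text \<open>Every image set arises from \<open>fact (card A)\<close> injections. Thus elementary
  symmetric polynomials are permanents with equal columns, and the covariance identity becomes
  available for them.\<close>

lemma per_on_const_columns:
  fixes y :: "'b \<Rightarrow> real"
  assumes "finite A" "finite S"
  shows "per_on (\<lambda>b _. y b) A S = fact (card A) * (\<Sum>K\<in>ksubsets S (card A). \<Prod>b\<in>K. y b)"
  using assms
proof (induction A arbitrary: S rule: finite_induct)
  case empty
  then show ?case by (simp add: ksubsets_0 per_on_def injs_empty)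
next
  case (insert a A)
  define k where "k = card A"
  have "per_on (\<lambda>b _. y b) (insert a A) S
    = (\<Sum>b\<in>S. y b * (fact k * (\<Sum>K\<in>ksubsets (S - {b}) k. \<Prod>b\<in>K. y b)))"
    using insert by (simp add: per_on_insert k_def)
  also have "\<dots> = fact k * (\<Sum>b\<in>S. \<Sum>K\<in>ksubsets (S - {b}) k. y b * (\<Prod>b\<in>K. y b))"
    by (simp add: sum_distrib_left mult_ac)
  also have "(\<Sum>b\<in>S. \<Sum>K\<in>ksubsets (S - {b}) k. y b * (\<Prod>b\<in>K. y b))
    = (\<Sum>K\<in>ksubsets S (Suc k). \<Sum>b\<in>K. y b * (\<Prod>b\<in>K - {b}. y b))"
    using insert by (simp add: sum_ksubsets_swap sum_ksubsets_insert)
  also have "\<dots> = (\<Sum>K\<in>ksubsets S (Suc k). real (Suc k) * (\<Prod>b\<in>K. y b))"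
  proof (intro sum.cong refl)
    fix K assume K: "K \<in> ksubsets S (Suc k)"
    then have "finite K" "card K = Suc k" using insert by (auto simp: ksubsets_def intro: finite_subset)
    then show "(\<Sum>b\<in>K. y b * (\<Prod>b\<in>K - {b}. y b)) = real (Suc k) * (\<Prod>b\<in>K. y b)"
      by (simp add: prod.remove[symmetric])
  qed
  finally show ?case using insert by (simp add: k_def flip: sum_distrib_left)
qed

lemma per_avg_nonneg:
  assumes "\<And>b t. b \<in> B \<Longrightarrow> t \<in> A \<Longrightarrow> 0 \<le> x b t"
  shows "0 \<le> per_avg x A B"
  unfolding per_avg_def by (intro mult_nonneg_nonneg divide_nonneg_nonneg per_on_nonneg assms) auto

text \<open>When all columns are equal, the covariance term in \<open>per_avg_insert_diff\<close> is minus a sum of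
  squares.\<close>

lemma per_avg_const_columns_le:
  fixes y :: "'b \<Rightarrow> real"
  assumes "finite A" "finite S" "card A \<le> card S" and y: "\<And>b. b \<in> S \<Longrightarrow> 0 \<le> y b"
  shows "per_avg (\<lambda>b _. y b) A S \<le> ((\<Sum>b\<in>S. y b) / card S) ^ card A"
  using assms(1,3)
proof (induction A rule: finite_induct)
  case empty
  then show ?case by (simp add: per_avg_empty)
next
  case (insert a A)
  have "0 \<le> (\<Sum>s\<in>A. 1 / (real (card S) * (real (card S) - 1)) *
        (\<Sum>u\<in>S. \<Sum>v\<in>S - {u}. (y u - y v) * (y u - y v) * per_avg (\<lambda>b _. y b) (A - {s}) (S - {u, v})))"
    using insert y
    by (intro sum_nonneg mult_nonneg_nonneg[OF zero_le_square] mult_nonneg_nonneg[of "1 / _"] per_avg_nonneg) auto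
  then have "per_avg (\<lambda>b _. y b) (insert a A) S \<le> (\<Sum>b\<in>S. y b) / card S * per_avg (\<lambda>b _. y b) A S"
    using per_avg_insert_diff[of a A S "\<lambda>b _. y b"] insert assms(2)
    by (smt (verit) card_insert_disjoint Suc_le_eq mult_minus_left mult_nonneg_nonneg
        divide_nonneg_nonneg of_nat_0_le_iff)
  also have "\<dots> \<le> (\<Sum>b\<in>S. y b) / card S * ((\<Sum>b\<in>S. y b) / card S) ^ card A"
    using insert y by (intro mult_left_mono) (auto intro!: divide_nonneg_nonneg sum_nonneg)
  finally show ?case using insert by simp
qed

text \<open>The elementary symmetric mean of order \<open>k\<close> is the \<open>per_avg\<close> of
  \<open>k\<close> equal columns, already compared with the power of the arithmetic mean. For
  \<open>k > card S\<close> both sides vanish.\<close>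

lemma maclaurin_ineq:
  fixes y :: "'b \<Rightarrow> real"
  assumes S: "finite S" and y: "\<And>b. b \<in> S \<Longrightarrow> 0 \<le> y b"
  shows "(\<Sum>K\<in>ksubsets S k. \<Prod>b\<in>K. y b) \<le> real (card S choose k) * ((\<Sum>b\<in>S. y b) / card S) ^ k"
proof (cases "k \<le> card S")
  case True
  define e where "e = (\<Sum>K\<in>ksubsets S k. \<Prod>b\<in>K. y b)"
  have "per_avg (\<lambda>b _. y b) {..<k} S \<le> ((\<Sum>b\<in>S. y b) / card S) ^ k"
    using per_avg_const_columns_le[of "{..<k}" S y] True S y by simp
  moreover have "per_avg (\<lambda>b _. y b) {..<k} S = e / real (card S choose k)"
    unfolding per_avg_def using per_on_const_columns[of "{..<k}" S y] S True
    by (simp add: binomial_fact e_def)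
  moreover have "card S choose k > 0" using True by simp
  ultimately show ?thesis by (simp add: field_simps e_def)
next
  case False
  then have "ksubsets S k = {}" using S by (auto simp: ksubsets_def dest: card_mono)
  then show ?thesis using False by (simp add: binomial_eq_0)
qed

section \<open>Interpolation between means and permanent\<close>

definition col_avg :: "('b \<Rightarrow> 'a \<Rightarrow> real) \<Rightarrow> 'b set \<Rightarrow> 'a \<Rightarrow> real" where
  "col_avg x B r = (\<Sum>b\<in>B. x b r) / card B"

text \<open>The covariance term of \<open>per_avg_insert_diff\<close>, with \<open>K\<close> for the
  columns \<open>A - {s}\<close>.\<close>

definition pair_cov :: "('b \<Rightarrow> 'a \<Rightarrow> real) \<Rightarrow> 'b set \<Rightarrow> 'a \<Rightarrow> 'a \<Rightarrow> 'a set \<Rightarrow> real" where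
  "pair_cov x B r s K = 1 / (real (card B) * (real (card B) - 1)) *
     (\<Sum>u\<in>B. \<Sum>v\<in>B - {u}. (x u r - x v r) * (x u s - x v s) * per_avg x K (B - {u, v}))"

text \<open>\<open>vartheta\<close> is the root mean square of this quantity over ordered pairs of
  distinct columns.\<close>

definition pair_spread :: "('b \<Rightarrow> 'a \<Rightarrow> real) \<Rightarrow> 'b set \<Rightarrow> 'a \<Rightarrow> 'a \<Rightarrow> real" where
  "pair_spread x B r s = 1 / (real (card B) * (real (card B) - 1)) *
     (\<Sum>u\<in>B. \<Sum>v\<in>B - {u}. \<bar>(x u r - x v r) * (x u s - x v s)\<bar>)"

text \<open>Interpolates between the product of the column means (\<open>k = 0\<close>) and the averaged permanent
  (\<open>k = card S\<close>).\<close>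

definition mixed_avg :: "('b \<Rightarrow> 'a \<Rightarrow> real) \<Rightarrow> 'a set \<Rightarrow> 'b set \<Rightarrow> nat \<Rightarrow> real" where
  "mixed_avg x S B k =
     (\<Sum>A\<in>ksubsets S k. per_avg x A B * (\<Prod>l\<in>S - A. col_avg x B l)) / real (card S choose k)"

lemma mixed_avg_0: "finite S \<Longrightarrow> mixed_avg x S B 0 = (\<Prod>l\<in>S. col_avg x B l)"
  by (simp add: mixed_avg_def ksubsets_0 per_avg_empty)

lemma mixed_avg_card: "finite S \<Longrightarrow> mixed_avg x S B (card S) = per_avg x S B"
  by (simp add: mixed_avg_def ksubsets_card)

section \<open>Increments of the interpolation\<close>

lemma diff_times_binomial: "(n - k) * (n choose k) = Suc k * (n choose Suc k)"
  using binomial_absorb_comp[of n k] binomial_absorption[of k n] by (simp add: mult.commute)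

text \<open>Both neighbouring averages become sums over a \<open>j\<close>-set \<open>A\<close> and
  a column \<open>r\<close> outside it: in the larger one \<open>r\<close> is a marked element of
  the set, in the smaller one the mean of \<open>r\<close> is split off the product. Each summand of
  the difference is then a covariance identity.\<close>

lemma mixed_avg_diff:
  assumes "finite S" "finite B" "j < card S" "card S \<le> card B"
  shows "real ((card S - j) * (card S choose j)) * (mixed_avg x S B (Suc j) - mixed_avg x S B j)
    = - (1 / (2 * card B)) * (\<Sum>A\<in>ksubsets S j. \<Sum>r\<in>S - A. \<Sum>s\<in>A.
        pair_cov x B r s (A - {s}) * (\<Prod>l\<in>S - insert r A. col_avg x B l))"
proof -
  define m where "m = (\<lambda>l. col_avg x B l)"
  have fin: "finite A" "A \<subseteq> S" "card A = k" if "A \<in> ksubsets S k" for A k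
    using that assms(1) by (auto simp: ksubsets_def intro: finite_subset)
  note c = diff_times_binomial[of "card S" j]
  have ne: "0 < card S choose Suc j" using assms(3) by simp
  have "real ((card S - j) * (card S choose j)) * mixed_avg x S B (Suc j)
    = real (Suc j) * (\<Sum>A\<in>ksubsets S (Suc j). per_avg x A B * (\<Prod>l\<in>S - A. m l))"
    unfolding c mixed_avg_def m_def using ne by (simp del: of_nat_Suc mult_Suc)
  also have "\<dots> = (\<Sum>A\<in>ksubsets S (Suc j). \<Sum>r\<in>A. per_avg x (insert r (A - {r})) B * (\<Prod>l\<in>S - insert r (A - {r}). m l))"
    unfolding sum_distrib_left using fin(3)
    by (intro sum.cong refl) (simp add: insert_absorb)
  also have "\<dots> = (\<Sum>A\<in>ksubsets S j. \<Sum>r\<in>S - A. per_avg x (insert r A) B * (\<Prod>l\<in>S - insert r A. m l))"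
    by (rule sum_ksubsets_insert[OF assms(1), symmetric])
  finally have e1: "real ((card S - j) * (card S choose j)) * mixed_avg x S B (Suc j) = \<dots>" .
  have "real ((card S - j) * (card S choose j)) * mixed_avg x S B j
    = real (card S - j) * (\<Sum>A\<in>ksubsets S j. per_avg x A B * (\<Prod>l\<in>S - A. m l))"
    unfolding mixed_avg_def m_def using assms(3) by simp
  also have "\<dots> = (\<Sum>A\<in>ksubsets S j. \<Sum>r\<in>S - A. m r * per_avg x A B * (\<Prod>l\<in>S - insert r A. m l))"
    unfolding sum_distrib_left
  proof (intro sum.cong refl)
    fix A assume A: "A \<in> ksubsets S j"
    have *: "m r * per_avg x A B * (\<Prod>l\<in>S - insert r A. m l) = per_avg x A B * (\<Prod>l\<in>S - A. m l)"
      if "r \<in> S - A" for r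
    proof -
      have "S - insert r A = S - A - {r}" by auto
      then show ?thesis using prod.remove[of "S - A" r m] that assms(1) by simp
    qed
    have "card (S - A) = card S - j" using fin[OF A] by (simp add: card_Diff_subset)
    moreover have "(\<Sum>r\<in>S - A. m r * per_avg x A B * (\<Prod>l\<in>S - insert r A. m l))
      = (\<Sum>r\<in>S - A. per_avg x A B * (\<Prod>l\<in>S - A. m l))" by (rule sum.cong[OF refl *])
    ultimately show "real (card S - j) * (per_avg x A B * (\<Prod>l\<in>S - A. m l))
      = (\<Sum>r\<in>S - A. m r * per_avg x A B * (\<Prod>l\<in>S - insert r A. m l))" by simp
  qed
  finally have e2: "real ((card S - j) * (card S choose j)) * mixed_avg x S B j = \<dots>" .
  have "real ((card S - j) * (card S choose j)) * (mixed_avg x S B (Suc j) - mixed_avg x S B j)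
    = (\<Sum>A\<in>ksubsets S j. \<Sum>r\<in>S - A.
        (per_avg x (insert r A) B - m r * per_avg x A B) * (\<Prod>l\<in>S - insert r A. m l))"
    unfolding right_diff_distrib e1 e2 by (simp add: sum_subtractf left_diff_distrib)
  also have "\<dots> = (\<Sum>A\<in>ksubsets S j. \<Sum>r\<in>S - A.
        - (1 / (2 * card B)) * (\<Sum>s\<in>A. pair_cov x B r s (A - {s}) * (\<Prod>l\<in>S - insert r A. m l)))"
  proof (intro sum.cong refl)
    fix A r assume A: "A \<in> ksubsets S j" and r: "r \<in> S - A"
    have "per_avg x (insert r A) B - m r * per_avg x A B
      = - (1 / (2 * card B)) * (\<Sum>s\<in>A. pair_cov x B r s (A - {s}))"
      unfolding m_def col_avg_def pair_cov_def using fin[OF A] r assms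
      by (intro per_avg_insert_diff) auto
    then show "(per_avg x (insert r A) B - m r * per_avg x A B) * (\<Prod>l\<in>S - insert r A. m l)
      = - (1 / (2 * card B)) * (\<Sum>s\<in>A. pair_cov x B r s (A - {s}) * (\<Prod>l\<in>S - insert r A. m l))"
      by (simp add: sum_distrib_right)
  qed
  finally show ?thesis by (simp only: sum_distrib_left m_def)
qed

text \<open>A single random row is uniform, so one column alone reproduces its mean. Hence the first
  increment vanishes and the final sum starts at 2.\<close>

lemma mixed_avg_1:
  assumes "finite S" "finite B" "0 < card S" "card S \<le> card B"
  shows "mixed_avg x S B 1 = mixed_avg x S B 0"
  using mixed_avg_diff[OF assms(1-4), of x] assms by (auto simp: ksubsets_0)

text \<open>Substituting \<open>K = A - {s}\<close> brings the pair of columns \<open>s\<close>,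
  \<open>r\<close> to the outside, so that the row differences can be separated from the sum over
  \<open>K\<close>.\<close>

lemma mixed_avg_diff_Suc:
  assumes "finite S" "finite B" "Suc i < card S" "card S \<le> card B"
  shows "real ((card S - Suc i) * (card S choose Suc i)) *
      (mixed_avg x S B (Suc (Suc i)) - mixed_avg x S B (Suc i))
    = - (1 / (2 * card B)) * (\<Sum>s\<in>S. \<Sum>r\<in>S - {s}. \<Sum>K\<in>ksubsets (S - {s, r}) i.
        pair_cov x B r s K * (\<Prod>l\<in>S - {s, r} - K. col_avg x B l))"
proof -
  define H where "H K s r = pair_cov x B r s K * (\<Prod>l\<in>S - {s, r} - K. col_avg x B l)" for K s r
  have "(\<Sum>A\<in>ksubsets S (Suc i). \<Sum>r\<in>S - A. \<Sum>s\<in>A.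
        pair_cov x B r s (A - {s}) * (\<Prod>l\<in>S - insert r A. col_avg x B l))
    = (\<Sum>A\<in>ksubsets S (Suc i). \<Sum>s\<in>A. \<Sum>r\<in>S - insert s (A - {s}). H (A - {s}) s r)"
  proof (rule sum.cong[OF refl])
    fix A
    have "(\<Sum>r\<in>S - A. \<Sum>s\<in>A. pair_cov x B r s (A - {s}) * (\<Prod>l\<in>S - insert r A. col_avg x B l))
      = (\<Sum>s\<in>A. \<Sum>r\<in>S - A. pair_cov x B r s (A - {s}) * (\<Prod>l\<in>S - insert r A. col_avg x B l))"
      by (rule sum.swap)
    also have "\<dots> = (\<Sum>s\<in>A. \<Sum>r\<in>S - insert s (A - {s}). H (A - {s}) s r)"
    proof (intro sum.cong)
      fix s r assume s: "s \<in> A"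
      then show "S - A = S - insert s (A - {s})" by auto
      have "S - insert r A = S - {s, r} - (A - {s})" using s by auto
      then show "pair_cov x B r s (A - {s}) * (\<Prod>l\<in>S - insert r A. col_avg x B l) = H (A - {s}) s r"
        by (simp add: H_def)
    qed simp_all
    finally show "(\<Sum>r\<in>S - A. \<Sum>s\<in>A. pair_cov x B r s (A - {s}) * (\<Prod>l\<in>S - insert r A. col_avg x B l))
      = (\<Sum>s\<in>A. \<Sum>r\<in>S - insert s (A - {s}). H (A - {s}) s r)" .
  qed
  also have "\<dots> = (\<Sum>A\<in>ksubsets S i. \<Sum>s\<in>S - A. \<Sum>r\<in>S - insert s A. H A s r)"
    by (rule sum_ksubsets_insert[OF assms(1), symmetric])
  also have "\<dots> = (\<Sum>s\<in>S. \<Sum>r\<in>S - {s}. \<Sum>K\<in>ksubsets (S - {s, r}) i. H K s r)"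
    by (rule sum_ksubsets_swap2[OF assms(1), symmetric])
  finally show ?thesis unfolding mixed_avg_diff[OF assms] H_def by simp
qed

lemma sum_ksubsets_compl:
  assumes "finite S" "k \<le> card S"
  shows "(\<Sum>A\<in>ksubsets S k. h (S - A)) = (\<Sum>L\<in>ksubsets S (card S - k). h L)"
  by (rule sum.reindex_bij_witness[where i = "\<lambda>A. S - A" and j = "\<lambda>A. S - A"])
    (use assms in \<open>auto simp: ksubsets_def card_Diff_subset finite_subset double_diff\<close>)

text \<open>The complement of \<open>L\<close> has \<open>i + 2\<close> elements, and
  \<open>s\<close> and \<open>r\<close> are an ordered pair of distinct ones among them.\<close>

lemma sum_pairs_ksubsets_compl:
  fixes h :: "'a set \<Rightarrow> real"
  assumes "finite S" "Suc (Suc i) \<le> card S"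
  shows "(\<Sum>s\<in>S. \<Sum>r\<in>S - {s}. \<Sum>K\<in>ksubsets (S - {s, r}) i. h (S - {s, r} - K))
    = real (Suc i) * real (Suc (Suc i)) * (\<Sum>L\<in>ksubsets S (card S - Suc (Suc i)). h L)"
proof -
  have eq: "S - {s, r} - K = S - insert r (insert s K)" for s r K by auto
  have count: "(\<Sum>A\<in>ksubsets S k. \<Sum>b\<in>S - A. g (insert b A))
    = real (Suc k) * (\<Sum>A\<in>ksubsets S (Suc k). g A)" for g :: "'a set \<Rightarrow> real" and k
    unfolding sum_ksubsets_insert[OF assms(1)] sum_distrib_left
    by (intro sum.cong refl) (simp add: insert_absorb ksubsets_def)
  have "(\<Sum>s\<in>S. \<Sum>r\<in>S - {s}. \<Sum>K\<in>ksubsets (S - {s, r}) i. h (S - {s, r} - K))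
    = (\<Sum>K\<in>ksubsets S i. \<Sum>s\<in>S - K. \<Sum>r\<in>S - insert s K. h (S - insert r (insert s K)))"
    unfolding eq by (rule sum_ksubsets_swap2[OF assms(1)])
  also have "\<dots> = real (Suc i) * (\<Sum>A\<in>ksubsets S (Suc i). \<Sum>r\<in>S - A. h (S - insert r A))"
    by (rule count)
  also have "(\<Sum>A\<in>ksubsets S (Suc i). \<Sum>r\<in>S - A. h (S - insert r A))
    = real (Suc (Suc i)) * (\<Sum>A\<in>ksubsets S (Suc (Suc i)). h (S - A))"
    by (rule count)
  finally show ?thesis using sum_ksubsets_compl[OF assms, of h] by simp
qed

section \<open>Bound for a single increment\<close>

lemma cauchy_schwarz_sqrt:
  fixes f g :: "'i \<Rightarrow> real"
  assumes "\<And>i. i \<in> A \<Longrightarrow> 0 \<le> f i" "\<And>i. i \<in> A \<Longrightarrow> 0 \<le> g i"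
  shows "(\<Sum>i\<in>A. f i * g i) \<le> sqrt (\<Sum>i\<in>A. (f i)\<^sup>2) * sqrt (\<Sum>i\<in>A. (g i)\<^sup>2)"
proof -
  have "(\<Sum>i\<in>A. f i * g i) = (\<Sum>i\<in>A. \<bar>f i\<bar> * \<bar>g i\<bar>)"
    using assms by (intro sum.cong) auto
  then show ?thesis using L2_set_mult_ineq[of f g A] by (simp add: L2_set_def)
qed

text \<open>This bounds the increment that becomes the term \<open>k = i + 2\<close> of
  \<open>f_poly\<close>. Cauchy-Schwarz over the sets \<open>K\<close> separates the means from the
  factors \<open>q\<close>; Cauchy-Schwarz over pairs of columns separates the spreads from the
  means. The mean of the squares of \<open>q\<close> is bounded only for \<open>0 < i\<close>, which
  guarantees \<open>card S > 2\<close> and hence a positive divisor.\<close>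

lemma mixed_avg_step_bound:
  fixes x :: "'b \<Rightarrow> 'a \<Rightarrow> real" and q :: "'b \<Rightarrow> 'b \<Rightarrow> 'a \<Rightarrow> real"
  assumes fin: "finite S" "finite B" and i: "Suc (Suc i) \<le> card S" and card: "card S \<le> card B"
    and x: "\<And>b l. b \<in> B \<Longrightarrow> l \<in> S \<Longrightarrow> 0 \<le> x b l"
    and q: "\<And>u v l. 0 \<le> q u v l"
    and per: "\<And>u v K. u \<in> B \<Longrightarrow> v \<in> B \<Longrightarrow> u \<noteq> v \<Longrightarrow> K \<in> ksubsets S i
      \<Longrightarrow> per_avg x K (B - {u, v}) \<le> (\<Prod>t\<in>K. q u v t)"
    and mean: "\<And>u v r s. u \<in> B \<Longrightarrow> v \<in> B \<Longrightarrow> u \<noteq> v \<Longrightarrow> r \<in> S \<Longrightarrow> s \<in> S \<Longrightarrow> r \<noteq> s \<Longrightarrow> 0 < i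
      \<Longrightarrow> (\<Sum>l\<in>S - {s, r}. (q u v l)\<^sup>2) / (real (card S) - 2) \<le> \<kappa>"
    and kappa: "0 \<le> \<kappa>"
  shows "\<bar>mixed_avg x S B (Suc (Suc i)) - mixed_avg x S B (Suc i)\<bar>
    \<le> 1 / (2 * card B) * (sqrt (\<Sum>s\<in>S. \<Sum>r\<in>S - {s}. (pair_spread x B r s)\<^sup>2)
        / sqrt (real (card S) * (real (card S) - 1))) *
      (real (Suc i) * sqrt ((\<Sum>l\<in>S. (col_avg x B l)\<^sup>2) / card S) ^ (card S - Suc (Suc i)) * sqrt \<kappa> ^ i)"
proof -
  define n where "n = card S"
  define N where "N = card B"
  define m where "m = (\<lambda>l. col_avg x B l)"
  define \<beta> where "\<beta> = (\<Sum>l\<in>S. (m l)\<^sup>2) / n"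
  define a where "a s r = pair_spread x B r s" for s r
  define G where "G s r = (\<Sum>K\<in>ksubsets (S - {s, r}) i. (\<Prod>l\<in>S - {s, r} - K. m l)\<^sup>2)" for s r
  define E where "E = real (n - 2 choose i) * \<kappa> ^ i"
  define c where "c = real (Suc (Suc i)) * real (n choose Suc (Suc i))"
  have n: "n \<ge> 2" "N \<ge> 2" using i card by (auto simp: n_def N_def)
  have m0: "0 \<le> m l" if "l \<in> S" for l
    unfolding m_def col_avg_def using x that by (intro divide_nonneg_nonneg sum_nonneg) auto
  have \<beta>0: "\<beta> \<ge> 0" unfolding \<beta>_def by (simp add: sum_nonneg)
  have G0: "G s r \<ge> 0" for s r unfolding G_def by (simp add: sum_nonneg)
  have E0: "E \<ge> 0" unfolding E_def using kappa by simp
  have w0: "1 / (real N * (real N - 1)) \<ge> 0" using n by simp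
  have a0: "a s r \<ge> 0" for s r unfolding a_def pair_spread_def N_def[symmetric]
    using w0 by (intro mult_nonneg_nonneg sum_nonneg) auto
  have c0: "c > 0" using i by (simp add: c_def n_def)
  have inner: "\<bar>\<Sum>K\<in>ksubsets (S - {s, r}) i. pair_cov x B r s K * (\<Prod>l\<in>S - {s, r} - K. m l)\<bar>
      \<le> a s r * sqrt (G s r) * sqrt E" if sr: "s \<in> S" "r \<in> S - {s}" for s r
  proof -
    define T where "T = S - {s, r}"
    have "card {s, r} = 2" using sr by auto
    then have T: "finite T" "card T = n - 2" "T \<subseteq> S"
      using fin sr by (auto simp: T_def n_def card_Diff_subset)
    have TS: "K \<in> ksubsets S i" "K \<subseteq> S" if "K \<in> ksubsets T i" for K
      using that T by (auto simp: ksubsets_def)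
    have M0: "0 \<le> (\<Prod>l\<in>T - K. m l)" for K using m0 T by (intro prod_nonneg) auto
    have qsum: "(\<Sum>K\<in>ksubsets T i. (\<Prod>l\<in>T - K. m l) * (\<Prod>t\<in>K. q u v t)) \<le> sqrt (G s r) * sqrt E"
      if uv: "u \<in> B" "v \<in> B - {u}" for u v
    proof -
      have "(\<Sum>K\<in>ksubsets T i. (\<Prod>t\<in>K. q u v t)\<^sup>2) = (\<Sum>K\<in>ksubsets T i. \<Prod>t\<in>K. (q u v t)\<^sup>2)"
        by (simp add: prod_power_distrib)
      \<comment> \<open>Maclaurin's inequality for the squares of \<open>q u v t\<close>, whose mean
        over \<open>T\<close> is at most \<open>\<kappa>\<close>; for \<open>i = 0\<close> the bound
        and \<open>E\<close> are both 1.\<close>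
      also have "\<dots> \<le> real (card T choose i) * ((\<Sum>t\<in>T. (q u v t)\<^sup>2) / card T) ^ i"
        by (intro maclaurin_ineq T) simp
      also have "\<dots> \<le> E"
      proof (cases "i = 0")
        case True then show ?thesis by (simp add: E_def)
      next
        case False
        have "(\<Sum>t\<in>T. (q u v t)\<^sup>2) / card T \<le> \<kappa>"
          using mean[of u v r s] uv(1) uv(2)[THEN DiffD1] uv(2)[THEN DiffD2] sr False n
          by (auto simp add: T T_def[symmetric] n_def[symmetric] of_nat_diff)
        then show ?thesis unfolding E_def T(2)
          by (intro mult_left_mono power_mono) (auto intro!: divide_nonneg_nonneg sum_nonneg)
      qed
      finally have "sqrt (\<Sum>K\<in>ksubsets T i. (\<Prod>t\<in>K. q u v t)\<^sup>2) \<le> sqrt E" by simp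
      then have "sqrt (G s r) * sqrt (\<Sum>K\<in>ksubsets T i. (\<Prod>t\<in>K. q u v t)\<^sup>2) \<le> sqrt (G s r) * sqrt E"
        using G0[of s r] by (intro mult_left_mono) auto
      moreover have "(\<Sum>K\<in>ksubsets T i. (\<Prod>l\<in>T - K. m l) * (\<Prod>t\<in>K. q u v t))
        \<le> sqrt (G s r) * sqrt (\<Sum>K\<in>ksubsets T i. (\<Prod>t\<in>K. q u v t)\<^sup>2)"
        unfolding G_def T_def[symmetric]
        using m0 T(3) q by (intro cauchy_schwarz_sqrt prod_nonneg) auto
      ultimately show ?thesis by linarith
    qed
    have "\<bar>\<Sum>K\<in>ksubsets T i. pair_cov x B r s K * (\<Prod>l\<in>T - K. m l)\<bar>
      \<le> (\<Sum>K\<in>ksubsets T i. \<bar>pair_cov x B r s K * (\<Prod>l\<in>T - K. m l)\<bar>)" by (rule sum_abs)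
    also have "\<dots> \<le> (\<Sum>K\<in>ksubsets T i. \<Sum>u\<in>B. \<Sum>v\<in>B - {u}. 1 / (real N * (real N - 1)) *
       \<bar>(x u r - x v r) * (x u s - x v s)\<bar> * ((\<Prod>l\<in>T - K. m l) * (\<Prod>t\<in>K. q u v t)))"
    proof (intro sum_mono)
      fix K assume K: "K \<in> ksubsets T i"
      have "\<bar>\<Sum>u\<in>B. \<Sum>v\<in>B - {u}. (x u r - x v r) * (x u s - x v s) * per_avg x K (B - {u, v})\<bar>
        \<le> (\<Sum>u\<in>B. \<Sum>v\<in>B - {u}. \<bar>(x u r - x v r) * (x u s - x v s)\<bar> * (\<Prod>t\<in>K. q u v t))"
      proof (intro order_trans[OF sum_abs] sum_mono)
        fix u v assume uv: "u \<in> B" "v \<in> B - {u}"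
        have "0 \<le> per_avg x K (B - {u, v})" using x TS(2)[OF K] by (intro per_avg_nonneg) auto
        moreover have "per_avg x K (B - {u, v}) \<le> (\<Prod>t\<in>K. q u v t)"
          using uv TS(1)[OF K] by (intro per) auto
        ultimately show "\<bar>(x u r - x v r) * (x u s - x v s) * per_avg x K (B - {u, v})\<bar>
          \<le> \<bar>(x u r - x v r) * (x u s - x v s)\<bar> * (\<Prod>t\<in>K. q u v t)"
          unfolding abs_mult[of _ "per_avg _ _ _"] by (intro mult_left_mono) auto
      qed
      then have "1 / (real N * (real N - 1)) *
          \<bar>\<Sum>u\<in>B. \<Sum>v\<in>B - {u}. (x u r - x v r) * (x u s - x v s) * per_avg x K (B - {u, v})\<bar>
          * (\<Prod>l\<in>T - K. m l)
        \<le> 1 / (real N * (real N - 1)) *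
          (\<Sum>u\<in>B. \<Sum>v\<in>B - {u}. \<bar>(x u r - x v r) * (x u s - x v s)\<bar> * (\<Prod>t\<in>K. q u v t))
          * (\<Prod>l\<in>T - K. m l)"
        using w0 M0 by (intro mult_right_mono mult_left_mono)
      moreover have "\<bar>pair_cov x B r s K * (\<Prod>l\<in>T - K. m l)\<bar> = 1 / (real N * (real N - 1)) *
          \<bar>\<Sum>u\<in>B. \<Sum>v\<in>B - {u}. (x u r - x v r) * (x u s - x v s) * per_avg x K (B - {u, v})\<bar>
          * (\<Prod>l\<in>T - K. m l)"
        unfolding pair_cov_def N_def[symmetric] abs_mult abs_of_nonneg[OF w0] abs_of_nonneg[OF M0] ..
      ultimately show "\<bar>pair_cov x B r s K * (\<Prod>l\<in>T - K. m l)\<bar>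
        \<le> (\<Sum>u\<in>B. \<Sum>v\<in>B - {u}. 1 / (real N * (real N - 1)) *
         \<bar>(x u r - x v r) * (x u s - x v s)\<bar> * ((\<Prod>l\<in>T - K. m l) * (\<Prod>t\<in>K. q u v t)))"
        by (simp add: sum_distrib_left sum_distrib_right mult_ac)
    qed
    also have "\<dots> = (\<Sum>u\<in>B. \<Sum>v\<in>B - {u}. 1 / (real N * (real N - 1)) *
       \<bar>(x u r - x v r) * (x u s - x v s)\<bar> * (\<Sum>K\<in>ksubsets T i. (\<Prod>l\<in>T - K. m l) * (\<Prod>t\<in>K. q u v t)))"
      unfolding sum_distrib_left by (subst sum.swap, intro sum.cong refl, rule sum.swap)
    also have "\<dots> \<le> (\<Sum>u\<in>B. \<Sum>v\<in>B - {u}. 1 / (real N * (real N - 1)) *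
       \<bar>(x u r - x v r) * (x u s - x v s)\<bar> * (sqrt (G s r) * sqrt E))"
      using w0 by (intro sum_mono mult_left_mono qsum mult_nonneg_nonneg) auto
    also have "\<dots> = a s r * sqrt (G s r) * sqrt E"
      unfolding a_def pair_spread_def N_def[symmetric] sum_distrib_left sum_distrib_right
      by (simp add: mult_ac)
    finally show ?thesis by (simp add: T_def)
  qed
  define A where "A = (\<Sum>s\<in>S. \<Sum>r\<in>S - {s}. (a s r)\<^sup>2)"
  \<comment> \<open>\<open>G s r\<close> depends only on sets \<open>L\<close> of means disjoint
    from \<open>s\<close>, \<open>r\<close>; counting how often each \<open>L\<close> occurs leaves
    an elementary symmetric polynomial of the squared means, to which Maclaurin's inequality
    applies.\<close>
  have sumG: "(\<Sum>s\<in>S. \<Sum>r\<in>S - {s}. G s r) \<le> real (Suc i) * c * \<beta> ^ (n - Suc (Suc i))"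
  proof -
    have "(\<Sum>L\<in>ksubsets S (n - Suc (Suc i)). (\<Prod>l\<in>L. m l)\<^sup>2)
      = (\<Sum>L\<in>ksubsets S (n - Suc (Suc i)). \<Prod>l\<in>L. (m l)\<^sup>2)" by (simp add: prod_power_distrib)
    also have "\<dots> \<le> real (n choose (n - Suc (Suc i))) * \<beta> ^ (n - Suc (Suc i))"
      unfolding \<beta>_def n_def by (intro maclaurin_ineq fin) simp
    also have "n choose (n - Suc (Suc i)) = n choose Suc (Suc i)"
      using i by (intro binomial_symmetric[symmetric]) (simp add: n_def)
    finally have "real (Suc i) * real (Suc (Suc i)) * (\<Sum>L\<in>ksubsets S (n - Suc (Suc i)). (\<Prod>l\<in>L. m l)\<^sup>2)
      \<le> real (Suc i) * real (Suc (Suc i)) * (real (n choose Suc (Suc i)) * \<beta> ^ (n - Suc (Suc i)))"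
      by (intro mult_left_mono) auto
    then show ?thesis
      using sum_pairs_ksubsets_compl[OF fin(1) i, of "\<lambda>L. (\<Prod>l\<in>L. m l)\<^sup>2"]
      by (simp add: G_def c_def n_def mult.assoc)
  qed
  have "(\<Sum>s\<in>S. \<Sum>r\<in>S - {s}. a s r * sqrt (G s r))
    \<le> sqrt A * sqrt (\<Sum>s\<in>S. \<Sum>r\<in>S - {s}. G s r)"
  proof -
    have pairs: "(\<Sum>s\<in>S. \<Sum>r\<in>S - {s}. h s r) = (\<Sum>p\<in>(SIGMA s:S. S - {s}). h (fst p) (snd p))" for h :: "'a \<Rightarrow> 'a \<Rightarrow> real"
      using fin by (subst sum.Sigma) (auto simp: case_prod_beta)
    show ?thesis unfolding A_def pairs
      using cauchy_schwarz_sqrt[of "SIGMA s:S. S - {s}" "\<lambda>p. a (fst p) (snd p)" "\<lambda>p. sqrt (G (fst p) (snd p))"]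
      by (simp add: a0 G0)
  qed
  also have "\<dots> \<le> sqrt A * sqrt (real (Suc i) * c * \<beta> ^ (n - Suc (Suc i)))"
    using sumG by (intro mult_left_mono) (auto simp: A_def intro!: sum_nonneg)
  finally have sumaG: "(\<Sum>s\<in>S. \<Sum>r\<in>S - {s}. a s r * sqrt (G s r))
    \<le> sqrt A * sqrt (real (Suc i) * c * \<beta> ^ (n - Suc (Suc i)))" .
  have cn: "real ((n - Suc i) * (n choose Suc i)) = c"
    by (simp only: c_def diff_times_binomial of_nat_mult)
  \<comment> \<open>Two absorption identities express the binomial coefficient in \<open>E\<close>
    by \<open>c\<close>, so the two square roots share the factor
    \<open>sqrt (real (Suc i) * c)\<close>.\<close>
  have cE: "real (Suc i) * c = real n * (real n - 1) * real (n - 2 choose i)"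
  proof -
    have "Suc i * (Suc (Suc i) * (n choose Suc (Suc i))) = Suc i * (n * (n - 1 choose Suc i))"
      using binomial_absorption[of "Suc i" n] by simp
    also have "\<dots> = n * (Suc i * (n - 1 choose Suc i))" by (simp only: mult.left_commute)
    also have "Suc i * (n - 1 choose Suc i) = (n - 1) * (n - 2 choose i)"
      using binomial_absorption[of i "n - 1"] by (simp add: numeral_2_eq_2)
    finally have "real (Suc i * (Suc (Suc i) * (n choose Suc (Suc i)))) = real (n * ((n - 1) * (n - 2 choose i)))"
      by (rule arg_cong)
    moreover have "real (n - 1) = real n - 1" using n by simp
    ultimately show ?thesis by (simp only: c_def of_nat_mult mult.assoc)
  qed
  have "c * \<bar>mixed_avg x S B (Suc (Suc i)) - mixed_avg x S B (Suc i)\<bar>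
    = \<bar>real ((n - Suc i) * (n choose Suc i)) * (mixed_avg x S B (Suc (Suc i)) - mixed_avg x S B (Suc i))\<bar>"
    by (simp only: cn abs_mult abs_of_pos[OF c0])
  also have "\<dots> = 1 / (2 * N) * \<bar>\<Sum>s\<in>S. \<Sum>r\<in>S - {s}. \<Sum>K\<in>ksubsets (S - {s, r}) i.
        pair_cov x B r s K * (\<Prod>l\<in>S - {s, r} - K. m l)\<bar>"
    unfolding n_def m_def N_def using mixed_avg_diff_Suc[OF fin, of i x] i card
    by (simp add: abs_mult)
  also have "\<dots> \<le> 1 / (2 * N) * (\<Sum>s\<in>S. \<Sum>r\<in>S - {s}. a s r * sqrt (G s r) * sqrt E)"
    by (intro mult_left_mono order_trans[OF sum_abs] sum_mono inner) auto
  also have "\<dots> = 1 / (2 * N) * ((\<Sum>s\<in>S. \<Sum>r\<in>S - {s}. a s r * sqrt (G s r)) * sqrt E)"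
    by (simp add: sum_distrib_right)
  also have "\<dots> \<le> 1 / (2 * N) * (sqrt A * sqrt (real (Suc i) * c * \<beta> ^ (n - Suc (Suc i))) * sqrt E)"
    using E0 by (intro mult_left_mono mult_right_mono sumaG) auto
  \<comment> \<open>The shared factor is squared: \<open>c\<close> cancels against the left-hand
    side, \<open>Suc i\<close> is the coefficient in \<open>f_poly\<close>, and the root of
    \<open>n * (n - 1)\<close> is the one in \<open>vartheta\<close>.\<close>
  also have "\<dots> = c * (1 / (2 * N) * (sqrt A / sqrt (real n * (real n - 1))) *
      (real (Suc i) * sqrt \<beta> ^ (n - Suc (Suc i)) * sqrt \<kappa> ^ i))"
  proof -
    define d where "d = real n * (real n - 1)"
    define b where "b = sqrt (real (Suc i) * c)"
    have d: "d > 0" using n by (simp add: d_def)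
    have "real (n - 2 choose i) = real (Suc i) * c / d"
      unfolding cE d_def[symmetric] using d by simp
    then have 1: "sqrt E = b / sqrt d * sqrt \<kappa> ^ i"
      unfolding E_def b_def by (simp only: real_sqrt_mult real_sqrt_divide real_sqrt_power)
    have 2: "sqrt (real (Suc i) * c * \<beta> ^ (n - Suc (Suc i))) = b * sqrt \<beta> ^ (n - Suc (Suc i))"
      unfolding b_def by (simp only: real_sqrt_mult real_sqrt_power)
    have "sqrt A * sqrt (real (Suc i) * c * \<beta> ^ (n - Suc (Suc i))) * sqrt E
      = sqrt A * (b * b) * sqrt \<beta> ^ (n - Suc (Suc i)) / sqrt d * sqrt \<kappa> ^ i"
      unfolding 1 2 by simp
    moreover have "b * b = real (Suc i) * c" unfolding b_def using c0 by simp
    ultimately have "sqrt A * sqrt (real (Suc i) * c * \<beta> ^ (n - Suc (Suc i))) * sqrt E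
      = sqrt A * (real (Suc i) * c) * sqrt \<beta> ^ (n - Suc (Suc i)) / sqrt d * sqrt \<kappa> ^ i"
      by simp
    then show ?thesis unfolding d_def[symmetric] by (simp add: mult_ac)
  qed
  finally show ?thesis
    unfolding mult_le_cancel_left_pos[OF c0] A_def a_def \<beta>_def m_def n_def N_def .
qed

section \<open>Transfer to the matrix of the theorem\<close>

lemma sum_distinct_pairs:
  "(\<Sum>(u, v)\<in>distinct_pairs m. h u v) = (\<Sum>u=1..m. \<Sum>v\<in>{1..m} - {u}. h u v)"
proof -
  have "distinct_pairs m = (SIGMA u:{1..m}. {1..m} - {u})" by (auto simp: distinct_pairs_def)
  then show ?thesis by (simp add: sum.Sigma)
qed

lemma finite_distinct_pairs: "finite (distinct_pairs m)"
  by (rule finite_subset[of _ "{1..m} \<times> {1..m}"]) (auto simp: distinct_pairs_def)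

lemma Per_eq_per_avg:
  "fact (N - n) / fact N * real (Per N n z) = per_avg (\<lambda>j r. real (z j r)) {1..n} {1..N}"
  by (simp add: per_avg_def per_on_def Per_def injs_def inj_tuples_def)

lemma sum_kappa_entry_le:
  assumes "2 < n" "(u, v) \<in> distinct_pairs N" "(r, s) \<in> distinct_pairs n"
  shows "(\<Sum>l\<in>{1..n} - {r, s}. kappa_entry N z u v l) / (real n - 2) \<le> kappa N n z"
proof -
  define F where "F = (\<lambda>((u, v), (r, s)). \<Sum>l\<in>{1..n} - {r, s}. kappa_entry N z u v l)"
  have "F ((u, v), (r, s)) \<le> Max (F ` (distinct_pairs N \<times> distinct_pairs n))"
    using assms by (intro Max_ge) (auto simp: finite_distinct_pairs)
  then have "F ((u, v), (r, s)) / (real n - 2)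
    \<le> Max (F ` (distinct_pairs N \<times> distinct_pairs n)) / (real n - 2)"
    using assms by (intro divide_right_mono) auto
  then show ?thesis using assms by (simp add: kappa_def F_def)
qed

theorem theorem4p3:
  fixes N n :: nat and z :: "nat \<Rightarrow> nat \<Rightarrow> nat"
  assumes "2 \<le> n" and "n \<le> N"
    and "\<And>j r. j \<in> {1..N} \<Longrightarrow> r \<in> {1..n} \<Longrightarrow> z j r \<in> {0, 1}"
  shows "\<bar>fact (N - n) / fact N * real (Per N n z) - (\<Prod>r=1..n. col_mean N z r)\<bar>
           \<le> vartheta N n z / (2 * real N) * f_poly n (sqrt (beta N n z)) (sqrt (kappa N n z))"
proof -
  define x where "x = (\<lambda>j r. real (z j r))"
  define S where "S = {1..n}"
  define B where "B = {1..N}"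
  \<comment> \<open>The Bregman-Minc factor for the \<open>N - 2\<close> rows left after deleting
    \<open>u\<close> and \<open>v\<close>; its square is \<open>kappa_entry\<close>.\<close>
  define q where "q u v l = zeta (eta N z u v l) / fact (N - 2) powr (1 / real (N - 2))" for u v l
  have fin: "finite S" "finite B" "card S = n" "card B = N" by (auto simp: S_def B_def)
  have q0: "0 \<le> q u v l" for u v l by (simp add: q_def zeta_nonneg)
  have q2: "(q u v l)\<^sup>2 = kappa_entry N z u v l" for u v l
  proof -
    have "(fact (N - 2) powr (1 / real (N - 2)))\<^sup>2 = (fact (N - 2) powr (2 / (real N - 2)) :: real)"
      using assms by (simp add: powr_power of_nat_diff)
    then show ?thesis by (simp add: q_def kappa_entry_def power_divide)
  qed
  \<comment> \<open>The maximum dominates the nonnegative sum for rows 1, 2 and columns 1, 2, which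
    exist since \<open>N \<ge> n \<ge> 2\<close>.\<close>
  have kappa: "0 \<le> kappa N n z"
  proof (cases "2 < n")
    case True
    have "0 \<le> (\<Sum>l\<in>{1..n} - {1, 2}. kappa_entry N z 1 2 l) / (real n - 2)"
      using True by (intro divide_nonneg_nonneg sum_nonneg) (auto simp flip: q2)
    also have "\<dots> \<le> kappa N n z"
      using True assms by (intro sum_kappa_entry_le) (auto simp: distinct_pairs_def)
    finally show ?thesis .
  qed (simp add: kappa_def)
  have avg: "col_avg x B r = col_mean N z r" for r
    by (simp add: col_avg_def col_mean_def x_def B_def)
  have theta: "vartheta N n z = sqrt (\<Sum>s\<in>S. \<Sum>r\<in>S - {s}. (pair_spread x B r s)\<^sup>2) / sqrt (real n * (real n - 1))"
  proof -
    define w where "w = 1 / (real N * (real N - 1))"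
    define V where "V s r = (\<Sum>(u, v)\<in>distinct_pairs N. \<bar>row_diff z u v s * row_diff z u v r\<bar>)" for s r
    have w0: "w \<ge> 0" using assms by (simp add: w_def)
    have "pair_spread x B r s = w * V s r" for r s
      unfolding pair_spread_def V_def sum_distinct_pairs
      by (simp add: w_def B_def x_def row_diff_def mult.commute)
    then have "(\<Sum>s\<in>S. \<Sum>r\<in>S - {s}. (pair_spread x B r s)\<^sup>2) = w\<^sup>2 * (\<Sum>(s, r)\<in>distinct_pairs n. (V s r)\<^sup>2)"
      unfolding sum_distinct_pairs S_def by (simp add: power_mult_distrib sum_distrib_left)
    then have "sqrt (\<Sum>s\<in>S. \<Sum>r\<in>S - {s}. (pair_spread x B r s)\<^sup>2)
      = w * sqrt (\<Sum>(s, r)\<in>distinct_pairs n. (V s r)\<^sup>2)"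
      using w0 by (simp add: real_sqrt_mult)
    then show ?thesis by (simp add: vartheta_def V_def w_def)
  qed
  have beta: "(\<Sum>l\<in>S. (col_avg x B l)\<^sup>2) / n = beta N n z"
    by (simp add: beta_def avg S_def)
  have step: "\<bar>mixed_avg x S B (Suc (Suc i)) - mixed_avg x S B (Suc i)\<bar>
    \<le> vartheta N n z / (2 * real N) *
      (real (Suc i) * sqrt (beta N n z) ^ (n - Suc (Suc i)) * sqrt (kappa N n z) ^ i)"
    if i: "i + 2 \<le> n" for i
  proof -
    have "\<bar>mixed_avg x S B (Suc (Suc i)) - mixed_avg x S B (Suc i)\<bar>
      \<le> 1 / (2 * card B) * (sqrt (\<Sum>s\<in>S. \<Sum>r\<in>S - {s}. (pair_spread x B r s)\<^sup>2)
          / sqrt (real (card S) * (real (card S) - 1))) *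
        (real (Suc i) * sqrt ((\<Sum>l\<in>S. (col_avg x B l)\<^sup>2) / card S) ^ (card S - Suc (Suc i))
          * sqrt (kappa N n z) ^ i)"
    proof (rule mixed_avg_step_bound[where q = q])
      fix u v K assume uv: "u \<in> B" "v \<in> B" "u \<noteq> v" and K: "K \<in> ksubsets S i"
      have "card {u, v} = 2" using uv by auto
      then have card: "card (B - {u, v}) = N - 2" using uv fin by (simp add: card_Diff_subset)
      have KS: "finite K" "K \<subseteq> S" "card K = i"
        using K fin by (auto simp: ksubsets_def intro: finite_subset)
      have "z b t \<in> {0, 1}" if "b \<in> B - {u, v}" "t \<in> K" for b t
        using that KS(2) by (intro assms(3)) (auto simp: S_def B_def)
      then have "per_avg x K (B - {u, v})
        \<le> (\<Prod>t\<in>K. zeta (\<Sum>b\<in>B - {u, v}. z b t) / fact (card (B - {u, v})) powr (1 / card (B - {u, v})))"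
        unfolding x_def using fin card i assms(2) KS by (intro per_avg_le_prod_zeta) auto
      then show "per_avg x K (B - {u, v}) \<le> (\<Prod>t\<in>K. q u v t)"
        by (simp add: q_def eta_def card) (simp add: B_def)
    next
      fix u v r s assume *: "u \<in> B" "v \<in> B" "u \<noteq> v" "r \<in> S" "s \<in> S" "r \<noteq> s" "0 < i"
      then have "(\<Sum>l\<in>{1..n} - {s, r}. kappa_entry N z u v l) / (real n - 2) \<le> kappa N n z"
        using i by (intro sum_kappa_entry_le) (auto simp: distinct_pairs_def S_def B_def)
      then show "(\<Sum>l\<in>S - {s, r}. (q u v l)\<^sup>2) / (real (card S) - 2) \<le> kappa N n z"
        by (simp add: q2 S_def)
    qed (use fin i assms kappa q0 in \<open>auto simp: x_def\<close>)
    then show ?thesis unfolding fin(3,4) beta theta by (simp add: mult_ac)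
  qed
  \<comment> \<open>The product of means is the value at 0, which equals the value at 1, so
    telescoping starts there.\<close>
  have "per_avg x S B - (\<Prod>r\<in>S. col_avg x B r) = mixed_avg x S B (Suc (n - 1)) - mixed_avg x S B 1"
    using mixed_avg_1[of S B x] mixed_avg_0[of S x B] mixed_avg_card[of S x B] fin assms by simp
  also have "\<dots> = (\<Sum>k\<in>{1..<n}. mixed_avg x S B (Suc k) - mixed_avg x S B k)"
    using assms by (subst sum_Suc_diff') auto
  also have "\<dots> = (\<Sum>k=2..n. mixed_avg x S B k - mixed_avg x S B (k - 1))"
    by (rule sum.reindex_bij_witness[where i = "\<lambda>k. k - 1" and j = Suc]) auto
  finally have "\<bar>per_avg x S B - (\<Prod>r\<in>S. col_avg x B r)\<bar>
    = \<bar>\<Sum>k=2..n. mixed_avg x S B k - mixed_avg x S B (k - 1)\<bar>" by (rule arg_cong)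
  also have "\<dots> \<le> (\<Sum>k=2..n. vartheta N n z / (2 * real N) *
      ((real k - 1) * sqrt (beta N n z) ^ (n - k) * sqrt (kappa N n z) ^ (k - 2)))"
  proof (intro order_trans[OF sum_abs] sum_mono)
    fix k assume k: "k \<in> {2..n}"
    then have "k = Suc (Suc (k - 2))" unfolding atLeastAtMost_iff by linarith
    then obtain i where "k = Suc (Suc i)" by blast
    then show "\<bar>mixed_avg x S B k - mixed_avg x S B (k - 1)\<bar> \<le> vartheta N n z / (2 * real N) *
      ((real k - 1) * sqrt (beta N n z) ^ (n - k) * sqrt (kappa N n z) ^ (k - 2))"
      using step[of i] k by simp
  qed
  also have "\<dots> = vartheta N n z / (2 * real N) * f_poly n (sqrt (beta N n z)) (sqrt (kappa N n z))"
    unfolding f_poly_def by (rule sum_distrib_left[symmetric])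
  finally show ?thesis
    unfolding Per_eq_per_avg avg unfolding S_def B_def x_def .
qed

end
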